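(* Let $n\ge2$ and equip $\mathcal{G}^z_{n-1}$ with its standard labeling. For $\omega\in\Omega(\mathcal{G}^z_{n-1})$ and $1\le i\le n-1$, let $\ell_i$ be the multiplicity in $\omega$ of the edge $f_{n-i}$, where $f_p$ denotes the right vertical edge of $T_p$ if $p$ is odd and the top horizontal edge of $T_p$ if $p$ is even. Let $\varphi(\omega)$ be the permutation of $S_n$ with Lehmer code $(\ell_1,\dots,\ell_{n-1},0)$. Then: (a) $\varphi$ is a poset isomorphism from $\Omega(\mathcal{G}^z_{n-1})$ with the face twist order onto the set $\mathrm{Cat}_n$ of $132$-avoiding permutations in $S_n$ with the (restriction of the) Bruhat order. (b) The rank generating function of the face twist order on $\Omega(\mathcal{G}^z_{n-1})$ equals $C_n(q):=\sum_{\sigma\in\mathrm{Cat}_n}q^{\mathrm{inv}(\sigma)}$.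
   Context: Mixed dimer covers: for a finite graph $\mathcal{G}=(V,E)$ and $\mathbf{n}\colon V\to\mathbb{N}$, a mixed dimer cover is $\omega\colon E\to\mathbb{N}$ with $\sum_{e\ni v}\omega(e)=\mathbf{n}(v)$ for all $v$. Zigzag snake graph $\mathcal{G}^z_N$: union of unit squares $T_1,\dots,T_N$ with $T_{2j+1}$ having lower-left corner $(j,j)$ and $T_{2j}$ having lower-left corner $(j-1,j)$; vertices are lattice points on the tiles, edges the unit sides. Standard labeling: for $1\le k\le N$, if $k=2j+1$ both vertices $(j,j),(j+1,j)$ get label $k$, if $k=2j$ both $(j-1,j),(j-1,j+1)$ get label $k$; the two remaining vertices get label $N+1$. $\Omega(\mathcal{G}^z_N)$ is the set of mixed dimer covers for this labeling. Face twist order: properly 2-color vertices black/white so that, if $N$ is odd, the bottom-right vertex of $T_N$ is black, and if $N$ is even, the top-right vertex of $T_N$ is black. Traversing a square face counterclockwise, edges traversed black-to-white are even and white-to-black odd; if all odd edges of a face have positive multiplicity, decreasing them by $1$ and increasing the even edges by $1$ is a positive face twist; the face twist order is generated by $\omega<\omega'$ when $\omega'$ is obtained from $\omega$ by a positive face twist. The rank generating function is $\sum_\omega q^{\mathrm{rk}(\omega)}$, $\mathrm{rk}(\omega)$ being the minimal number of face twists to reach $\omega$ from the minimal element. Lehmer code of $\sigma\in S_n$: $L_i=\#\{j>i:\sigma(j)<\sigma(i)\}$. $\sigma$ is $132$-avoiding if there are no $j<k<l$ with $\sigma(j)<\sigma(l)<\sigma(k)$. $\mathrm{inv}(\sigma)$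 is the number of inversions. *)

theory Defs
  imports
    "HOL-Combinatorics.Permutations"
    "HOL-Computational_Algebra.Polynomial"
    "HOL-Library.FuncSet"
begin

section \<open>Mixed dimer covers\<close>

text \<open>
  A finite simple graph is given by its vertex set and its set of edges, an edge being the
  two-element set of its end points.  A cover is a function on the edge set only: it is
  \<^const>\<open>undefined\<close> off \<open>E\<close>, so that covers are equal iff they agree on \<open>E\<close>.
\<close>

definition mixed_dimer_covers ::
    "'v set \<Rightarrow> 'v set set \<Rightarrow> ('v \<Rightarrow> nat) \<Rightarrow> ('v set \<Rightarrow> nat) set" where
  "mixed_dimer_covers V E n =
     {\<omega> \<in> E \<rightarrow>\<^sub>E UNIV. \<forall>v\<in>V. (\<Sum>e\<in>{e \<in> E. v \<in> e}. \<omega> e) = n v}"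

definition proper_2_coloring :: "'v set set \<Rightarrow> ('v \<Rightarrow> bool) \<Rightarrow> bool" where
  "proper_2_coloring E black \<longleftrightarrow> (\<forall>u v. {u, v} \<in> E \<longrightarrow> black u \<noteq> black v)"


section \<open>Zigzag snake graphs and their standard labeling\<close>

type_synonym point = "nat \<times> nat"

text \<open>For even \<open>k\<close> only \<open>k \<ge> 2\<close> is used, so the subtraction does not truncate.\<close>

definition tile_corner :: "nat \<Rightarrow> point" where
  "tile_corner k = (if odd k then (k div 2, k div 2) else (k div 2 - 1, k div 2))"

definition bottom_left :: "nat \<Rightarrow> point" where
  "bottom_left k = tile_corner k"

definition bottom_right :: "nat \<Rightarrow> point" where
  "bottom_right k = (case tile_corner k of (x, y) \<Rightarrow> (x + 1, y))"

definition top_right :: "nat \<Rightarrow> point" where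
  "top_right k = (case tile_corner k of (x, y) \<Rightarrow> (x + 1, y + 1))"

definition top_left :: "nat \<Rightarrow> point" where
  "top_left k = (case tile_corner k of (x, y) \<Rightarrow> (x, y + 1))"

text \<open>The sides of \<open>T\<^sub>k\<close>, directed as they are traversed counterclockwise.\<close>

definition tile_boundary :: "nat \<Rightarrow> (point \<times> point) set" where
  "tile_boundary k =
     {(bottom_left k, bottom_right k), (bottom_right k, top_right k),
      (top_right k, top_left k), (top_left k, bottom_left k)}"

definition snake_vertices :: "nat \<Rightarrow> point set" where
  "snake_vertices N = (\<Union>k\<in>{1..N}. {bottom_left k, bottom_right k, top_right k, top_left k})"

definition snake_edges :: "nat \<Rightarrow> point set set" where
  "snake_edges N = (\<Union>k\<in>{1..N}. {{u, v} | u v. (u, v) \<in> tile_boundary k})"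

text \<open>The two vertices labeled \<open>k\<close>, for \<open>1 \<le> k \<le> N\<close>: the bottom side of \<open>T\<^sub>k\<close> for odd \<open>k\<close>
  and its left side for even \<open>k\<close>.  These pairs are disjoint for different \<open>k\<close>.\<close>

definition labeled_vertices :: "nat \<Rightarrow> point set" where
  "labeled_vertices k =
     (if odd k then {bottom_left k, bottom_right k} else {bottom_left k, top_left k})"

lemma labeled_vertices_disjoint:
  assumes "k \<ge> 1" "l \<ge> 1" "v \<in> labeled_vertices k" "v \<in> labeled_vertices l"
  shows "k = l"
proof -
  have *: "m = (if snd v \<le> fst v then 2 * snd v + 1 else 2 * (fst v + 1))"
    if "m \<ge> 1" "v \<in> labeled_vertices m" for m
  proof (cases "odd m")
    case True
    then obtain j where "m = 2 * j + 1" by (elim oddE)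
    with that show ?thesis
      by (auto simp: labeled_vertices_def bottom_left_def bottom_right_def tile_corner_def)
  next
    case False
    then obtain j where "m = 2 * j" by auto
    with that show ?thesis
      by (auto simp: labeled_vertices_def bottom_left_def top_left_def tile_corner_def)
  qed
  show ?thesis
    using *[OF assms(1,3)] *[OF assms(2,4)] by simp
qed

definition standard_label :: "nat \<Rightarrow> point \<Rightarrow> nat" where
  "standard_label N v =
     (if \<exists>k\<in>{1..N}. v \<in> labeled_vertices k
      then THE k. k \<in> {1..N} \<and> v \<in> labeled_vertices k
      else N + 1)"

definition zigzag_covers :: "nat \<Rightarrow> (point set \<Rightarrow> nat) set" where
  "zigzag_covers N =
     mixed_dimer_covers (snake_vertices N) (snake_edges N) (standard_label N)"


section \<open>The face twist order\<close>

definition snake_coloring :: "nat \<Rightarrow> (point \<Rightarrow> bool) \<Rightarrow> bool" where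
  "snake_coloring N black \<longleftrightarrow>
     proper_2_coloring (snake_edges N) black \<and>
     black (if odd N then bottom_right N else top_right N)"

lemma snake_coloring_checkerboard:
  assumes "N \<ge> 1"
  shows "snake_coloring N (\<lambda>(x, y). odd (x + y))"
proof -
  have "odd (fst u + snd u) \<noteq> odd (fst v + snd v)" if "(u, v) \<in> tile_boundary k" for u v k
    using that
    by (auto simp: tile_boundary_def bottom_left_def bottom_right_def top_right_def top_left_def
        split: prod.splits)
  then have "proper_2_coloring (snake_edges N) (\<lambda>(x, y). odd (x + y))"
    unfolding proper_2_coloring_def snake_edges_def case_prod_unfold
    by (smt (verit, best) UN_iff doubleton_eq_iff mem_Collect_eq)
  moreover have "(\<lambda>(x, y). odd (x + y)) (if odd N then bottom_right N else top_right N)"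
    using assms by (auto simp: bottom_right_def top_right_def tile_corner_def elim: oddE evenE)
  ultimately show ?thesis
    by (simp add: snake_coloring_def)
qed

definition even_edges :: "(point \<Rightarrow> bool) \<Rightarrow> nat \<Rightarrow> point set set" where
  "even_edges black k = {{u, v} | u v. (u, v) \<in> tile_boundary k \<and> black u \<and> \<not> black v}"

definition odd_edges :: "(point \<Rightarrow> bool) \<Rightarrow> nat \<Rightarrow> point set set" where
  "odd_edges black k = {{u, v} | u v. (u, v) \<in> tile_boundary k \<and> \<not> black u \<and> black v}"

definition positive_face_twist ::
    "(point \<Rightarrow> bool) \<Rightarrow> nat \<Rightarrow> (point set \<Rightarrow> nat) \<Rightarrow> (point set \<Rightarrow> nat) \<Rightarrow> bool" where
  "positive_face_twist black k \<omega> \<omega>' \<longleftrightarrow>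
     (\<forall>e\<in>odd_edges black k. \<omega> e > 0) \<and>
     \<omega>' = (\<lambda>e. if e \<in> odd_edges black k then \<omega> e - 1
               else if e \<in> even_edges black k then \<omega> e + 1 else \<omega> e)"

definition twist_step ::
    "nat \<Rightarrow> (point \<Rightarrow> bool) \<Rightarrow> (point set \<Rightarrow> nat) \<Rightarrow> (point set \<Rightarrow> nat) \<Rightarrow> bool" where
  "twist_step N black \<omega> \<omega>' \<longleftrightarrow>
     \<omega> \<in> zigzag_covers N \<and> \<omega>' \<in> zigzag_covers N \<and>
     (\<exists>k\<in>{1..N}. positive_face_twist black k \<omega> \<omega>')"

definition face_twist_order ::
    "nat \<Rightarrow> (point \<Rightarrow> bool) \<Rightarrow> ((point set \<Rightarrow> nat) \<times> (point set \<Rightarrow> nat)) set" where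
  "face_twist_order N black =
     {(\<omega>, \<omega>'). \<omega> \<in> zigzag_covers N \<and> \<omega>' \<in> zigzag_covers N \<and> (twist_step N black)\<^sup>*\<^sup>* \<omega> \<omega>'}"

definition minimal_cover :: "nat \<Rightarrow> (point \<Rightarrow> bool) \<Rightarrow> (point set \<Rightarrow> nat)" where
  "minimal_cover N black =
     (THE \<omega>. \<omega> \<in> zigzag_covers N \<and> (\<forall>\<omega>'. (\<omega>', \<omega>) \<in> face_twist_order N black \<longrightarrow> \<omega>' = \<omega>))"

definition twist_rank :: "nat \<Rightarrow> (point \<Rightarrow> bool) \<Rightarrow> (point set \<Rightarrow> nat) \<Rightarrow> nat" where
  "twist_rank N black \<omega> = (LEAST d. (twist_step N black ^^ d) (minimal_cover N black) \<omega>)"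

definition rank_generating_function :: "nat \<Rightarrow> (point \<Rightarrow> bool) \<Rightarrow> int poly" where
  "rank_generating_function N black = (\<Sum>\<omega>\<in>zigzag_covers N. monom 1 (twist_rank N black \<omega>))"


section \<open>Permutations of \<open>{1..n}\<close>\<close>

definition lehmer_code :: "nat \<Rightarrow> (nat \<Rightarrow> nat) \<Rightarrow> nat list" where
  "lehmer_code n \<sigma> = map (\<lambda>i. card {j \<in> {1..n}. j > i \<and> \<sigma> j < \<sigma> i}) [1..<n + 1]"

definition num_inversions :: "nat \<Rightarrow> (nat \<Rightarrow> nat) \<Rightarrow> nat" where
  "num_inversions n \<sigma> = card {(i, j). i \<in> {1..n} \<and> j \<in> {1..n} \<and> i < j \<and> \<sigma> j < \<sigma> i}"

definition avoids_132 :: "nat \<Rightarrow> (nat \<Rightarrow> nat) \<Rightarrow> bool" where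
  "avoids_132 n \<sigma> \<longleftrightarrow>
     \<not> (\<exists>j\<in>{1..n}. \<exists>k\<in>{1..n}. \<exists>l\<in>{1..n}. j < k \<and> k < l \<and> \<sigma> j < \<sigma> l \<and> \<sigma> l < \<sigma> k)"

definition Cat :: "nat \<Rightarrow> (nat \<Rightarrow> nat) set" where
  "Cat n = {\<sigma>. \<sigma> permutes {1..n} \<and> avoids_132 n \<sigma>}"

definition catalan_poly :: "nat \<Rightarrow> int poly" where
  "catalan_poly n = (\<Sum>\<sigma>\<in>Cat n. monom 1 (num_inversions n \<sigma>))"

text \<open>The (strong) Bruhat order: generated by right multiplication with arbitrary
  transpositions that increases the number of inversions.\<close>

definition bruhat_step :: "nat \<Rightarrow> (nat \<Rightarrow> nat) \<Rightarrow> (nat \<Rightarrow> nat) \<Rightarrow> bool" where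
  "bruhat_step n \<sigma> \<tau> \<longleftrightarrow>
     \<sigma> permutes {1..n} \<and>
     (\<exists>a\<in>{1..n}. \<exists>b\<in>{1..n}. a \<noteq> b \<and> \<tau> = \<sigma> \<circ> transpose a b) \<and>
     num_inversions n \<sigma> < num_inversions n \<tau>"

definition bruhat_order :: "nat \<Rightarrow> ((nat \<Rightarrow> nat) \<times> (nat \<Rightarrow> nat)) set" where
  "bruhat_order n =
     {(\<sigma>, \<tau>). \<sigma> permutes {1..n} \<and> \<tau> permutes {1..n} \<and> (bruhat_step n)\<^sup>*\<^sup>* \<sigma> \<tau>}"

definition poset_isomorphism ::
    "'a set \<Rightarrow> ('a \<times> 'a) set \<Rightarrow> 'b set \<Rightarrow> ('b \<times> 'b) set \<Rightarrow> ('a \<Rightarrow> 'b) \<Rightarrow> bool" where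
  "poset_isomorphism A r B s f \<longleftrightarrow>
     partial_order_on A r \<and> partial_order_on B s \<and> bij_betw f A B \<and>
     (\<forall>x\<in>A. \<forall>y\<in>A. (x, y) \<in> r \<longleftrightarrow> (f x, f y) \<in> s)"


section \<open>The map \<open>\<phi>\<close>\<close>

definition f_edge :: "nat \<Rightarrow> point set" where
  "f_edge p = (if odd p then {bottom_right p, top_right p} else {top_left p, top_right p})"

definition cover_code :: "nat \<Rightarrow> (point set \<Rightarrow> nat) \<Rightarrow> nat list" where
  "cover_code n \<omega> = map (\<lambda>i. \<omega> (f_edge (n - i))) [1..<n] @ [0]"

definition cover_perm :: "nat \<Rightarrow> (point set \<Rightarrow> nat) \<Rightarrow> (nat \<Rightarrow> nat)" where
  "cover_perm n \<omega> = (THE \<sigma>. \<sigma> permutes {1..n} \<and> lehmer_code n \<sigma> = cover_code n \<omega>)"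

end

theory Submission
  imports Defs
begin

text \<open>
  In a cover of the zigzag snake graph the values \<open>h k\<close> on the edges \<open>f\<^sub>k\<close> determine all other
  multiplicities: solving the vertex conditions along the snake, the remaining boundary edge of
  \<open>T\<^sub>k\<close> has multiplicity \<open>k - h k\<close> and the inner edges have multiplicities \<open>h k - h (k - 1)\<close>.  So
  covers correspond to weakly increasing sequences with \<open>h k \<le> k\<close>, a positive twist of \<open>T\<^sub>k\<close> adds
  one to \<open>h k\<close>, and the face twist order is the pointwise order, ranked by the sum of \<open>h\<close>.

  On the other side, \<open>\<sigma>\<close> avoids 132 iff its Lehmer code is weakly decreasing, and then
  \<open>L\<^sub>i + 1 = min (\<sigma>(1), \<dots>, \<sigma>(i))\<close>.  Prefix minima can only grow along a Bruhat step, so the Bruhat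
  order on these permutations implies the pointwise order of codes.  Conversely, raising one entry
  of the Lehmer code of any permutation by one is a Bruhat step.
\<close>

section \<open>Lehmer codes and the Bruhat order\<close>

definition code_at :: "nat \<Rightarrow> (nat \<Rightarrow> nat) \<Rightarrow> nat \<Rightarrow> nat" where
  "code_at n \<sigma> i = card {j \<in> {i<..n}. \<sigma> j < \<sigma> i}"

lemma lehmer_code_conv: "lehmer_code n \<sigma> = map (code_at n \<sigma>) [1..<n + 1]"
proof -
  have "{j \<in> {1..n}. i < j \<and> \<sigma> j < \<sigma> i} = {j \<in> {i<..n}. \<sigma> j < \<sigma> i}" if "i \<ge> 1" for i
    using that by auto
  then show ?thesis
    by (auto simp: lehmer_code_def code_at_def)
qed

lemma code_at_le: "code_at n \<sigma> i \<le> n - i"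
proof -
  have "code_at n \<sigma> i \<le> card {i<..n}"
    unfolding code_at_def by (intro card_mono) auto
  then show ?thesis by simp
qed

lemma num_inversions_eq_sum_code: "num_inversions n \<sigma> = (\<Sum>i\<in>{1..n}. code_at n \<sigma> i)"
proof -
  have "{(i, j). i \<in> {1..n} \<and> j \<in> {1..n} \<and> i < j \<and> \<sigma> j < \<sigma> i} =
      (SIGMA i:{1..n}. {j \<in> {i<..n}. \<sigma> j < \<sigma> i})"
    by auto
  then show ?thesis
    by (simp add: num_inversions_def code_at_def card_SigmaI)
qed

text \<open>Equal prefixes leave the same set of values for the positions \<open>i..n\<close>. The
  entry at \<open>i\<close> counts the remaining values below the value at \<open>i\<close>, so a
  larger value there counts strictly more.\<close>

lemma code_at_less_of_agree:
  assumes \<sigma>: "\<sigma> permutes {1..n}" and \<tau>: "\<tau> permutes {1..n}" and i: "i \<in> {1..n}"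
    and agree: "\<And>j. j \<in> {1..n} \<Longrightarrow> j < i \<Longrightarrow> \<sigma> j = \<tau> j" and less: "\<sigma> i < \<tau> i"
  shows "code_at n \<sigma> i < code_at n \<tau> i"
proof -
  have image: "\<rho> ` {i..n} = {1..n} - \<rho> ` {1..<i}" if "\<rho> permutes {1..n}" for \<rho>
  proof -
    have "{i..n} = {1..n} - {1..<i}" using i by auto
    then have "\<rho> ` {i..n} = \<rho> ` {1..n} - \<rho> ` {1..<i}"
      using image_set_diff[OF permutes_inj[OF that]] by simp
    then show ?thesis using permutes_image[OF that] by simp
  qed
  \<comment> \<open>Position \<open>i\<close> may be included because its value is not strictly
    below itself.\<close>
  have code: "code_at n \<rho> i = card {v \<in> \<rho> ` {i..n}. v < \<rho> i}" if "\<rho> permutes {1..n}" for \<rho>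
  proof -
    have "{v \<in> \<rho> ` {i..n}. v < \<rho> i} = \<rho> ` {j \<in> {i<..n}. \<rho> j < \<rho> i}"
      by (auto simp: image_iff) (metis atLeastAtMost_iff le_neq_implies_less less_irrefl)
    then show ?thesis
      by (simp add: code_at_def card_image inj_on_subset[OF permutes_inj[OF that]])
  qed
  have "\<sigma> ` {1..<i} = \<tau> ` {1..<i}"
    using agree i by (intro image_cong) auto
  then have same: "\<sigma> ` {i..n} = \<tau> ` {i..n}"
    by (simp add: image[OF \<sigma>] image[OF \<tau>])
  have "{v \<in> \<tau> ` {i..n}. v < \<sigma> i} \<subset> {v \<in> \<tau> ` {i..n}. v < \<tau> i}"
  proof
    show "{v \<in> \<tau> ` {i..n}. v < \<sigma> i} \<subseteq> {v \<in> \<tau> ` {i..n}. v < \<tau> i}"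
      using less by auto
    \<comment> \<open>The value \<open>\<sigma> i\<close> itself is counted for
      \<open>\<tau>\<close> but not for \<open>\<sigma>\<close>.\<close>
    have "\<sigma> i \<in> \<tau> ` {i..n}" unfolding same[symmetric] using i by auto
    then show "{v \<in> \<tau> ` {i..n}. v < \<sigma> i} \<noteq> {v \<in> \<tau> ` {i..n}. v < \<tau> i}"
      using less by blast
  qed
  then show ?thesis
    unfolding code[OF \<sigma>] code[OF \<tau>] same by (intro psubset_card_mono) auto
qed

text \<open>At a first position of disagreement \<open>code_at_less_of_agree\<close> would separate
  the codes; outside \<open>{1..n}\<close> both permutations are the identity.\<close>

lemma permutes_eq_of_code_at_eq:
  assumes \<sigma>: "\<sigma> permutes {1..n}" and \<tau>: "\<tau> permutes {1..n}"
    and eq: "\<And>i. i \<in> {1..n} \<Longrightarrow> code_at n \<sigma> i = code_at n \<tau> i"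
  shows "\<sigma> = \<tau>"
proof -
  have "\<sigma> i = \<tau> i" if "i \<in> {1..n}" for i
    using that
  proof (induction i rule: less_induct)
    case (less i)
    then show ?case
      using code_at_less_of_agree[OF \<sigma> \<tau>, of i] code_at_less_of_agree[OF \<tau> \<sigma>, of i] eq[of i]
      by (metis less_irrefl linorder_less_linear)
  qed
  then have "\<sigma> i = \<tau> i" for i
    using permutes_not_in[OF \<sigma>] permutes_not_in[OF \<tau>] by (cases "i \<in> {1..n}") auto
  then show ?thesis ..
qed

section \<open>Raising codes by Bruhat steps\<close>

text \<open>Swapping the value at \<open>i\<close> with the next larger value to its right raises the code by one at
  \<open>i\<close> and changes it nowhere else, because no value to the right of \<open>i\<close> lies between the two.\<close>

lemma code_at_increment:
  assumes \<sigma>: "\<sigma> permutes {1..n}" and i: "i \<in> {1..n}" and less: "code_at n \<sigma> i < n - i"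
  obtains \<tau> where "bruhat_step n \<sigma> \<tau>"
    and "\<And>j. j \<in> {1..n} \<Longrightarrow> code_at n \<tau> j = ((code_at n \<sigma>)(i := Suc (code_at n \<sigma> i))) j"
proof -
  have inj: "\<sigma> x = \<sigma> y \<longleftrightarrow> x = y" for x y
    using permutes_inj[OF \<sigma>] by (auto dest: injD)
  define B where "B = {j \<in> {i<..n}. \<sigma> i < \<sigma> j}"
  \<comment> \<open>An entry below \<open>n - i\<close> means that not every value to the right of
    \<open>i\<close> is smaller.\<close>
  have "B \<noteq> {}"
  proof
    assume "B = {}"
    then have "{j \<in> {i<..n}. \<sigma> j < \<sigma> i} = {i<..n}"
      using inj by (auto simp: B_def) (metis less_irrefl linorder_neqE_nat)
    then show False using less by (simp add: code_at_def)
  qed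
  then obtain b where b: "b \<in> B" and min: "\<And>j. j \<in> B \<Longrightarrow> \<sigma> b \<le> \<sigma> j"
    using ex_has_least_nat[of "\<lambda>j. j \<in> B" _ \<sigma>] by blast
  have ib: "i < b" "b \<le> n" "\<sigma> i < \<sigma> b" using b by (auto simp: B_def)
  have gap: "\<sigma> j < \<sigma> i \<or> \<sigma> b \<le> \<sigma> j" if "i < j" "j \<le> n" for j
    using min[of j] that inj[of i j] by (cases "\<sigma> i < \<sigma> j") (auto simp: B_def)
  define \<tau> where "\<tau> = \<sigma> \<circ> transpose i b"
  have \<tau>_simps: "\<tau> i = \<sigma> b" "\<tau> b = \<sigma> i" "\<And>j. j \<noteq> i \<Longrightarrow> j \<noteq> b \<Longrightarrow> \<tau> j = \<sigma> j"
    by (auto simp: \<tau>_def)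
  have code: "code_at n \<tau> j = ((code_at n \<sigma>)(i := Suc (code_at n \<sigma> i))) j" if j: "j \<in> {1..n}" for j
  proof -
    consider "j < i" | "j = i" | "i < j" "j < b" | "j = b" | "b < j" using ib by linarith
    then show ?thesis
    proof cases
      case 1
      \<comment> \<open>Both exchanged positions lie to the right of \<open>j\<close>, so the
        transposition matches the two sets of counted positions.\<close>
      have "{k \<in> {j<..n}. \<tau> k < \<tau> j} = transpose i b ` {k \<in> {j<..n}. \<sigma> k < \<sigma> j}" (is "?l = ?r")
      proof
        show "?r \<subseteq> ?l" using 1 ib by (auto simp: \<tau>_def transpose_def)
        show "?l \<subseteq> ?r"
        proof
          fix k assume "k \<in> ?l"
          then show "k \<in> ?r" using 1 ib
            by (intro image_eqI[of _ _ "transpose i b k"]) (auto simp: \<tau>_def transpose_def)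
        qed
      qed
      then show ?thesis using 1
        by (simp add: code_at_def card_image inj_on_subset[OF inj_transpose])
    next
      case 2
      have "{k \<in> {i<..n}. \<tau> k < \<tau> i} = insert b {k \<in> {i<..n}. \<sigma> k < \<sigma> i}"
      proof (intro set_eqI)
        fix k show "k \<in> {k \<in> {i<..n}. \<tau> k < \<tau> i} \<longleftrightarrow> k \<in> insert b {k \<in> {i<..n}. \<sigma> k < \<sigma> i}"
          using gap[of k] ib \<tau>_simps by (cases "k = b") (auto simp: \<tau>_simps)
      qed
      then show ?thesis using 2 ib by (simp add: code_at_def)
    next
      case 3
      \<comment> \<open>To the right of \<open>j\<close> only position \<open>b\<close> changes its
        value, and by \<open>gap\<close> at \<open>j\<close> the value \<open>\<sigma> j\<close>
        lies below both or above both exchanged values.\<close>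
      have "{k \<in> {j<..n}. \<tau> k < \<tau> j} = {k \<in> {j<..n}. \<sigma> k < \<sigma> j}"
      proof (intro set_eqI)
        fix k show "k \<in> {k \<in> {j<..n}. \<tau> k < \<tau> j} \<longleftrightarrow> k \<in> {k \<in> {j<..n}. \<sigma> k < \<sigma> j}"
          using gap[of j] ib 3 \<tau>_simps inj[of b j] by (cases "k = b") auto
      qed
      then show ?thesis using 3 by (simp add: code_at_def)
    next
      case 4
      have "{k \<in> {b<..n}. \<tau> k < \<tau> b} = {k \<in> {b<..n}. \<sigma> k < \<sigma> b}"
      proof (intro set_eqI)
        fix k show "k \<in> {k \<in> {b<..n}. \<tau> k < \<tau> b} \<longleftrightarrow> k \<in> {k \<in> {b<..n}. \<sigma> k < \<sigma> b}"
          using gap[of k] ib \<tau>_simps by auto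
      qed
      then show ?thesis using 4 ib by (simp add: code_at_def)
    next
      case 5
      then have "{k \<in> {j<..n}. \<tau> k < \<tau> j} = {k \<in> {j<..n}. \<sigma> k < \<sigma> j}"
        using ib \<tau>_simps by auto
      then show ?thesis using 5 ib by (simp add: code_at_def)
    qed
  qed
  have "num_inversions n \<sigma> < num_inversions n \<tau>"
    unfolding num_inversions_eq_sum_code using i
    by (intro sum_strict_mono_ex1) (auto simp: code simp del: fun_upd_apply, auto)
  then have "bruhat_step n \<sigma> \<tau>"
    using \<sigma> i ib unfolding bruhat_step_def \<tau>_def
    by (metis atLeastAtMost_iff dual_order.strict_trans1 less_imp_le_nat nat_neq_iff)
  then show ?thesis using code that by blast
qed

lemma bruhat_step_permutes:
  assumes "bruhat_step n \<sigma> \<tau>"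
  shows "\<sigma> permutes {1..n}" "\<tau> permutes {1..n}"
  using assms unfolding bruhat_step_def by (auto intro!: permutes_compose permutes_swap_id)

text \<open>Deficient entries are raised one at a time, in any order, until the total deficit is
  zero; the bound \<open>n - i\<close> on the target is what allows each increment. Intermediate
  permutations may contain 132, since the Bruhat order is that of the whole symmetric group.\<close>

lemma bruhat_steps_of_code_at_le:
  assumes \<sigma>: "\<sigma> permutes {1..n}" and c: "\<And>i. i \<in> {1..n} \<Longrightarrow> code_at n \<sigma> i \<le> c i"
    "\<And>i. i \<in> {1..n} \<Longrightarrow> c i \<le> n - i"
  obtains \<tau> where "(bruhat_step n)\<^sup>*\<^sup>* \<sigma> \<tau>" "\<tau> permutes {1..n}"
    "\<And>i. i \<in> {1..n} \<Longrightarrow> code_at n \<tau> i = c i"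
proof -
  have "\<exists>\<tau>. (bruhat_step n)\<^sup>*\<^sup>* \<sigma> \<tau> \<and> \<tau> permutes {1..n} \<and> (\<forall>i\<in>{1..n}. code_at n \<tau> i = c i)"
    using \<sigma> c(1)
  proof (induction "\<Sum>i\<in>{1..n}. c i - code_at n \<sigma> i" arbitrary: \<sigma> rule: less_induct)
    case less
    show ?case
    proof (cases "\<forall>i\<in>{1..n}. code_at n \<sigma> i = c i")
      case True
      then show ?thesis using less.prems(1) by blast
    next
      case False
      then obtain i where i: "i \<in> {1..n}" "code_at n \<sigma> i < c i"
        using less.prems(2) by (meson le_neq_implies_less)
      moreover have "code_at n \<sigma> i < n - i" using i c(2)[of i] by linarith
      ultimately obtain \<rho> where \<rho>: "bruhat_step n \<sigma> \<rho>"
        "\<And>j. j \<in> {1..n} \<Longrightarrow> code_at n \<rho> j = ((code_at n \<sigma>)(i := Suc (code_at n \<sigma> i))) j"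
        using code_at_increment[OF less.prems(1)] by blast
      have "(\<Sum>j\<in>{1..n}. c j - code_at n \<rho> j) < (\<Sum>j\<in>{1..n}. c j - code_at n \<sigma> j)"
        using i by (intro sum_strict_mono_ex1) (auto simp: \<rho>(2) intro!: bexI[of _ i])
      moreover have "code_at n \<rho> j \<le> c j" if "j \<in> {1..n}" for j
        using \<rho>(2)[OF that] less.prems(2)[OF that] i by simp
      ultimately obtain \<tau> where "(bruhat_step n)\<^sup>*\<^sup>* \<rho> \<tau>" "\<tau> permutes {1..n}"
          "\<forall>i\<in>{1..n}. code_at n \<tau> i = c i"
        using less.hyps[of \<rho>] bruhat_step_permutes[OF \<rho>(1)] by blast
      then show ?thesis using \<rho>(1) by (meson converse_rtranclp_into_rtranclp)
    qed
  qed
  then show ?thesis using that by blast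
qed

text \<open>The identity has code zero, which lies below every admissible \<open>c\<close>.\<close>

lemma ex_permutes_code_at:
  assumes "\<And>i. i \<in> {1..n} \<Longrightarrow> c i \<le> n - i"
  obtains \<sigma> where "\<sigma> permutes {1..n}" "\<And>i. i \<in> {1..n} \<Longrightarrow> code_at n \<sigma> i = c i"
proof -
  have "code_at n id i = 0" for i by (simp add: code_at_def)
  then show ?thesis
    using bruhat_steps_of_code_at_le[OF permutes_id, of n c] assms that by (metis le0)
qed

lemma bruhat_order_of_code_at_le:
  assumes "\<sigma> permutes {1..n}" "\<tau> permutes {1..n}"
    and "\<And>i. i \<in> {1..n} \<Longrightarrow> code_at n \<sigma> i \<le> code_at n \<tau> i"
  shows "(\<sigma>, \<tau>) \<in> bruhat_order n"
proof -
  obtain \<rho> where \<rho>: "(bruhat_step n)\<^sup>*\<^sup>* \<sigma> \<rho>" "\<rho> permutes {1..n}"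
    "\<And>i. i \<in> {1..n} \<Longrightarrow> code_at n \<rho> i = code_at n \<tau> i"
    using bruhat_steps_of_code_at_le[of \<sigma> n "code_at n \<tau>"] assms code_at_le by metis
  then have "\<rho> = \<tau>" using permutes_eq_of_code_at_eq assms(2) by blast
  then show ?thesis using assms \<rho> by (simp add: bruhat_order_def)
qed

section \<open>Prefix minima along Bruhat steps\<close>

text \<open>Inversions after the swap inject into those before it. Read contrapositively: a Bruhat
  step never exchanges an inverted pair.\<close>

lemma num_inversions_swap_le:
  assumes ab: "a < b" "a \<in> {1..n}" "b \<in> {1..n}" and less: "\<sigma> b < \<sigma> a"
  shows "num_inversions n (\<sigma> \<circ> transpose a b) \<le> num_inversions n \<sigma>"
proof -
  define t where "t = transpose a b"
  define I where "I = (\<lambda>\<rho> :: nat \<Rightarrow> nat. {(i, j). i \<in> {1..n} \<and> j \<in> {1..n} \<and> i < j \<and> \<rho> j < \<rho> i})"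
  \<comment> \<open>Pairs whose order \<open>t\<close> keeps are transported by \<open>t\<close>,
    the others stay put. As \<open>t\<close> is an involution, the image reveals which case applied,
    whence injectivity.\<close>
  define g where "g = (\<lambda>(i, j). if t i < t j then (t i, t j) else (i, j))"
  have tt: "t (t x) = x" for x by (simp add: t_def)
  have inj: "inj_on g (I (\<sigma> \<circ> t))"
  proof (rule inj_onI)
    fix p q assume pq: "p \<in> I (\<sigma> \<circ> t)" "q \<in> I (\<sigma> \<circ> t)" "g p = g q"
    obtain i j k l where ijkl: "p = (i, j)" "q = (k, l)" by fastforce
    then have "i < j" "k < l" using pq by (auto simp: I_def)
    moreover have "(if t i < t j then (t i, t j) else (i, j)) = (if t k < t l then (t k, t l) else (k, l))"
      using pq(3) ijkl by (simp add: g_def)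
    ultimately show "p = q"
      using ijkl by (cases "t i < t j"; cases "t k < t l") (simp; metis tt less_asym)+
  qed
  have "g (i, j) \<in> I \<sigma>" if "(i, j) \<in> I (\<sigma> \<circ> t)" for i j
  proof -
    have ij: "i \<in> {1..n}" "j \<in> {1..n}" "i < j" "\<sigma> (t j) < \<sigma> (t i)"
      using that by (auto simp: I_def)
    have "t i \<in> {1..n}" "t j \<in> {1..n}"
      using ij ab by (auto simp: t_def transpose_def)
    \<comment> \<open>A reversed pair has \<open>i = a\<close> or \<open>j = b\<close>; its
      inversion passes to \<open>\<sigma>\<close> by transitivity through
      \<open>\<sigma> b < \<sigma> a\<close>.\<close>
    moreover have "\<sigma> j < \<sigma> i" if "\<not> t i < t j"
    proof -
      consider "i = a" "j = b" | "i = a" "j \<noteq> b" | "i \<noteq> a" "j = b" | "i \<noteq> a" "j \<noteq> b" by blast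
      then show ?thesis
        using ij ab less that by cases (auto simp: t_def transpose_def split: if_splits)
    qed
    ultimately show ?thesis
      using ij by (simp add: g_def I_def)
  qed
  then have "g ` I (\<sigma> \<circ> t) \<subseteq> I \<sigma>" by auto
  moreover have "finite (I \<sigma>)"
    by (rule finite_subset[of _ "{1..n} \<times> {1..n}"]) (auto simp: I_def)
  ultimately have "card (I (\<sigma> \<circ> t)) \<le> card (I \<sigma>)"
    using card_inj_on_le[OF inj] by blast
  then show ?thesis by (simp add: num_inversions_def I_def t_def)
qed

text \<open>The exchanged pair \<open>a < b\<close> is not inverted, so the larger value moves to
  the left. Each value in a prefix of \<open>\<tau>\<close> then has a value of
  \<open>\<sigma>\<close> below it in the same prefix; position \<open>a\<close> serves for both
  \<open>a\<close> and \<open>b\<close>.\<close>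

lemma bruhat_step_Min_mono:
  assumes "bruhat_step n \<sigma> \<tau>" "i \<in> {1..n}"
  shows "Min (\<sigma> ` {1..i}) \<le> Min (\<tau> ` {1..i})"
proof -
  obtain a b where ab: "a \<in> {1..n}" "b \<in> {1..n}" "a < b" "\<tau> = \<sigma> \<circ> transpose a b"
    using assms(1) unfolding bruhat_step_def by (metis linorder_neqE_nat transpose_commute)
  have "\<not> \<sigma> b < \<sigma> a"
    using num_inversions_swap_le[OF ab(3,1,2), of \<sigma>] ab(4) assms(1)
    unfolding bruhat_step_def by auto
  then have "\<exists>k\<in>{1..i}. \<sigma> k \<le> \<tau> j" if "j \<in> {1..i}" for j
  proof -
    consider "j = a" | "j = b" | "j \<noteq> a" "j \<noteq> b" by blast
    then show ?thesis
    proof cases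
      case 1
      then show ?thesis using that ab \<open>\<not> \<sigma> b < \<sigma> a\<close> by (intro bexI[of _ a]) auto
    next
      case 2
      then show ?thesis using that ab by (intro bexI[of _ a]) auto
    next
      case 3
      then show ?thesis using that ab by (intro bexI[of _ j]) auto
    qed
  qed
  then show ?thesis
    using assms(2) by (intro Min.boundedI) (auto simp: Min_le_iff)
qed

section \<open>Codes of 132-avoiding permutations\<close>

text \<open>Under avoidance every position counted at \<open>j\<close> is also counted at an earlier
  \<open>i\<close>, as otherwise \<open>i\<close>, \<open>j\<close> and that position form a 132.
  Conversely, a 132 pattern forces an ascent of the code between two neighbouring positions.\<close>

lemma avoids_132_iff_code_at_antimono:
  assumes \<sigma>: "\<sigma> permutes {1..n}"
  shows "avoids_132 n \<sigma> \<longleftrightarrow> (\<forall>i j. 1 \<le> i \<and> i \<le> j \<and> j \<le> n \<longrightarrow> code_at n \<sigma> j \<le> code_at n \<sigma> i)"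
proof
  assume av: "avoids_132 n \<sigma>"
  have inj: "\<sigma> x = \<sigma> y \<longleftrightarrow> x = y" for x y
    using permutes_inj[OF \<sigma>] by (auto dest: injD)
  have "code_at n \<sigma> j \<le> code_at n \<sigma> i" if ij: "1 \<le> i" "i < j" "j \<le> n" for i j
    unfolding code_at_def
  proof (intro card_mono subsetI)
    fix k assume "k \<in> {k \<in> {j<..n}. \<sigma> k < \<sigma> j}"
    moreover from this have "i \<in> {1..n}" "j \<in> {1..n}" "k \<in> {1..n}" "j < k" "\<sigma> k < \<sigma> j"
      using ij by auto
    then have "\<not> \<sigma> i < \<sigma> k"
      using av ij(2) unfolding avoids_132_def by blast
    ultimately show "k \<in> {k \<in> {i<..n}. \<sigma> k < \<sigma> i}"
      using ij inj[of i k] by auto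
  qed auto
  then show "\<forall>i j. 1 \<le> i \<and> i \<le> j \<and> j \<le> n \<longrightarrow> code_at n \<sigma> j \<le> code_at n \<sigma> i"
    by (metis le_neq_implies_less order_refl)
next
  assume anti: "\<forall>i j. 1 \<le> i \<and> i \<le> j \<and> j \<le> n \<longrightarrow> code_at n \<sigma> j \<le> code_at n \<sigma> i"
  show "avoids_132 n \<sigma>"
    unfolding avoids_132_def
  proof
    assume "\<exists>j\<in>{1..n}. \<exists>k\<in>{1..n}. \<exists>l\<in>{1..n}. j < k \<and> k < l \<and> \<sigma> j < \<sigma> l \<and> \<sigma> l < \<sigma> k"
    then obtain j k l where jkl: "1 \<le> j" "j < k" "k < l" "l \<le> n" "\<sigma> j < \<sigma> l" "\<sigma> l < \<sigma> k"
      by auto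
    \<comment> \<open>\<open>m\<close> is the last position before \<open>k\<close> with value below
      \<open>\<sigma> l\<close>, so the value at \<open>Suc m\<close> exceeds
      \<open>\<sigma> l\<close>. All that is counted at \<open>m\<close> is counted at
      \<open>Suc m\<close>, and so is \<open>l\<close>.\<close>
    define A where "A = {m \<in> {j..<k}. \<sigma> m < \<sigma> l}"
    define m where "m = Max A"
    have "finite A" "A \<noteq> {}" using jkl by (auto simp: A_def)
    then have m: "m \<in> A" "\<And>x. x \<in> A \<Longrightarrow> x \<le> m"
      unfolding m_def by simp_all
    have Suc: "\<sigma> l < \<sigma> (Suc m)"
    proof (cases "Suc m = k")
      case False
      then have "Suc m \<in> {j..<k}" using m(1) by (simp add: A_def)
      moreover have "Suc m \<notin> A" using m(2)[of "Suc m"] by linarith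
      ultimately have "\<sigma> l \<le> \<sigma> (Suc m)" by (auto simp: A_def)
      moreover have "Suc m \<noteq> l" using \<open>Suc m \<in> {j..<k}\<close> jkl by auto
      ultimately show ?thesis
        using injD[OF permutes_inj[OF \<sigma>], of "Suc m" l] by linarith
    qed (use jkl in auto)
    have ml: "Suc m < l" "j \<le> m" "\<sigma> m < \<sigma> l" using m(1) jkl by (auto simp: A_def)
    have "{x \<in> {m<..n}. \<sigma> x < \<sigma> m} \<subset> {x \<in> {Suc m<..n}. \<sigma> x < \<sigma> (Suc m)}"
    proof
      show "{x \<in> {m<..n}. \<sigma> x < \<sigma> m} \<subseteq> {x \<in> {Suc m<..n}. \<sigma> x < \<sigma> (Suc m)}"
      proof
        fix x assume "x \<in> {x \<in> {m<..n}. \<sigma> x < \<sigma> m}"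
        then show "x \<in> {x \<in> {Suc m<..n}. \<sigma> x < \<sigma> (Suc m)}"
          using Suc ml by (cases "x = Suc m") auto
      qed
      have "l \<in> {x \<in> {Suc m<..n}. \<sigma> x < \<sigma> (Suc m)}" "l \<notin> {x \<in> {m<..n}. \<sigma> x < \<sigma> m}"
        using Suc ml jkl by simp_all
      then show "{x \<in> {m<..n}. \<sigma> x < \<sigma> m} \<noteq> {x \<in> {Suc m<..n}. \<sigma> x < \<sigma> (Suc m)}"
        by metis
    qed
    then have "code_at n \<sigma> m < code_at n \<sigma> (Suc m)"
      unfolding code_at_def by (intro psubset_card_mono) auto
    moreover have "code_at n \<sigma> (Suc m) \<le> code_at n \<sigma> m"
      using anti[rule_format, of m "Suc m"] ml jkl by simp
    ultimately show False by simp
  qed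
qed

text \<open>All values below the prefix minimum \<open>m\<close> occur after \<open>i\<close>. A
  counted value above \<open>m\<close> would form a 132 with \<open>m\<close> and
  \<open>\<sigma> i\<close>, so the counted values are exactly \<open>{1..<m}\<close>.\<close>

lemma Suc_code_at_eq_Min:
  assumes "\<sigma> \<in> Cat n" "i \<in> {1..n}"
  shows "Suc (code_at n \<sigma> i) = Min (\<sigma> ` {1..i})"
proof -
  have \<sigma>: "\<sigma> permutes {1..n}" and av: "avoids_132 n \<sigma>" using assms by (auto simp: Cat_def)
  define m where "m = Min (\<sigma> ` {1..i})"
  have m: "m \<in> \<sigma> ` {1..i}" "\<And>j. j \<in> {1..i} \<Longrightarrow> m \<le> \<sigma> j"
    using assms(2) unfolding m_def by (auto intro!: Min_in)
  then obtain k where k: "k \<in> {1..i}" "\<sigma> k = m" by auto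
  have "\<sigma> ` {j \<in> {i<..n}. \<sigma> j < \<sigma> i} = {1..<m}"
  proof (intro set_eqI iffI)
    fix v assume "v \<in> \<sigma> ` {j \<in> {i<..n}. \<sigma> j < \<sigma> i}"
    then obtain j where j: "i < j" "j \<le> n" "\<sigma> j < \<sigma> i" "v = \<sigma> j" by auto
    have "\<not> \<sigma> k < \<sigma> j" if "k \<noteq> i"
    proof -
      have "k \<in> {1..n}" "j \<in> {1..n}" "k < i" using k j assms(2) that by auto
      then show ?thesis using av assms(2) j unfolding avoids_132_def by blast
    qed
    moreover have "\<sigma> k \<noteq> \<sigma> j"
      using j(1) k(1) injD[OF permutes_inj[OF \<sigma>], of k j] by auto
    moreover have "\<sigma> j \<in> {1..n}" using permutes_in_image[OF \<sigma>] j assms(2) by simp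
    ultimately show "v \<in> {1..<m}" using j k by (cases "k = i") auto
  next
    fix v assume v: "v \<in> {1..<m}"
    have "m \<in> {1..n}" using permutes_in_image[OF \<sigma>, of k] k assms(2) by simp
    then have "v \<in> \<sigma> ` {1..n}" using v permutes_image[OF \<sigma>] by auto
    then obtain j where j: "j \<in> {1..n}" "v = \<sigma> j" by auto
    then have "j \<notin> {1..i}" using v m(2)[of j] by auto
    moreover have "m \<le> \<sigma> i" using m(2) assms(2) by auto
    ultimately show "v \<in> \<sigma> ` {j \<in> {i<..n}. \<sigma> j < \<sigma> i}" using j v by auto
  qed
  then have "code_at n \<sigma> i = card {1..<m}"
    using card_image[OF inj_on_subset[OF permutes_inj[OF \<sigma>] subset_UNIV],
        of "{j \<in> {i<..n}. \<sigma> j < \<sigma> i}"]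
    by (simp add: code_at_def)
  moreover have "m \<ge> 1" using permutes_in_image[OF \<sigma>, of k] k assms(2) by simp
  ultimately show ?thesis by (simp add: m_def)
qed

text \<open>Prefix minima are followed along the whole chain, whose inner members may leave
  \<open>Cat n\<close>; they are converted into codes only at its two ends.\<close>

lemma bruhat_order_Cat_iff:
  assumes "\<sigma> \<in> Cat n" "\<tau> \<in> Cat n"
  shows "(\<sigma>, \<tau>) \<in> bruhat_order n \<longleftrightarrow> (\<forall>i\<in>{1..n}. code_at n \<sigma> i \<le> code_at n \<tau> i)"
proof
  assume "(\<sigma>, \<tau>) \<in> bruhat_order n"
  then have steps: "(bruhat_step n)\<^sup>*\<^sup>* \<sigma> \<tau>" by (simp add: bruhat_order_def)
  show "\<forall>i\<in>{1..n}. code_at n \<sigma> i \<le> code_at n \<tau> i"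
  proof
    fix i assume i: "i \<in> {1..n}"
    from steps have "Min (\<sigma> ` {1..i}) \<le> Min (\<tau> ` {1..i})"
    proof induction
      case (step \<rho> \<tau>)
      then show ?case using bruhat_step_Min_mono[OF step.hyps(2) i] by linarith
    qed simp
    then show "code_at n \<sigma> i \<le> code_at n \<tau> i"
      using Suc_code_at_eq_Min[OF assms(1) i] Suc_code_at_eq_Min[OF assms(2) i] by simp
  qed
next
  assume "\<forall>i\<in>{1..n}. code_at n \<sigma> i \<le> code_at n \<tau> i"
  then show "(\<sigma>, \<tau>) \<in> bruhat_order n"
    using assms by (intro bruhat_order_of_code_at_le) (auto simp: Cat_def)
qed

lemma partial_order_on_bruhat_Cat: "partial_order_on (Cat n) (Restr (bruhat_order n) (Cat n))"
proof -
  have "antisym (bruhat_order n)"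
  proof (rule antisymI)
    fix \<sigma> \<tau> assume st: "(\<sigma>, \<tau>) \<in> bruhat_order n" "(\<tau>, \<sigma>) \<in> bruhat_order n"
    \<comment> \<open>Every nontrivial chain strictly increases the number of inversions, which
      rules out cycles.\<close>
    have "\<rho> = \<rho>' \<or> num_inversions n \<rho> < num_inversions n \<rho>'" if "(bruhat_step n)\<^sup>*\<^sup>* \<rho> \<rho>'" for \<rho> \<rho>'
      using that
    proof induction
      case (step \<rho>' \<rho>'')
      moreover have "num_inversions n \<rho>' < num_inversions n \<rho>''"
        using step.hyps(2) by (simp add: bruhat_step_def)
      ultimately show ?case by auto
    qed simp
    from this[of \<sigma> \<tau>] this[of \<tau> \<sigma>] st show "\<sigma> = \<tau>"
      unfolding bruhat_order_def by fastforce
  qed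
  moreover have "trans (bruhat_order n)"
    by (rule transI) (auto simp: bruhat_order_def)
  moreover have "refl_on (Cat n) (Restr (bruhat_order n) (Cat n))"
    by (auto simp: refl_on_def bruhat_order_def Cat_def)
  ultimately show ?thesis
    unfolding partial_order_on_def preorder_on_def
    by (intro conjI trans_Restr antisym_subset[OF _ \<open>antisym (bruhat_order n)\<close>]) simp_all
qed

section \<open>Height sequences\<close>

text \<open>Pinning \<open>h\<close> to the identity above \<open>N\<close> makes equality and the
  pointwise order of functions depend only on \<open>1..N\<close>, the value at 0 being forced to
  0.\<close>

definition heights :: "nat \<Rightarrow> (nat \<Rightarrow> nat) set" where
  "heights N = {h. mono h \<and> (\<forall>k. h k \<le> k) \<and> (\<forall>k>N. h k = k)}"

definition height_step :: "nat \<Rightarrow> (nat \<Rightarrow> nat) \<Rightarrow> (nat \<Rightarrow> nat) \<Rightarrow> bool" where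
  "height_step N h h' \<longleftrightarrow>
     h \<in> heights N \<and> h' \<in> heights N \<and> (\<exists>k\<in>{1..N}. h' = h(k := Suc (h k)))"

lemma heights_0: "h \<in> heights N \<Longrightarrow> h 0 = 0"
  unfolding heights_def by (metis (mono_tags) le_zero_eq mem_Collect_eq)

lemma height_step_sum:
  assumes "height_step N h h'"
  shows "sum h' {1..N} = Suc (sum h {1..N})"
proof -
  obtain k where k: "k \<in> {1..N}" "h' = h(k := Suc (h k))"
    using assms by (auto simp: height_step_def)
  then have "sum h' ({1..N} - {k}) = sum h ({1..N} - {k})" "h' k = Suc (h k)"
    by (auto intro: sum.cong)
  then show ?thesis
    using sum.remove[OF _ k(1), of h] sum.remove[OF _ k(1), of h'] by simp
qed

lemma height_steps_sum: "(height_step N ^^ d) h h' \<Longrightarrow> sum h' {1..N} = sum h {1..N} + d"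
  by (induction d arbitrary: h') (auto dest: height_step_sum)

lemma height_steps_mono:
  assumes "(height_step N)\<^sup>*\<^sup>* h h'"
  shows "h \<le> h'"
  using assms
proof induction
  case (step h' h'')
  then have "h' \<le> h''" by (auto simp: height_step_def le_fun_def)
  then show ?case using step.IH by (rule order_trans[rotated])
qed simp

text \<open>Raise \<open>h\<close> at the last position \<open>k\<close> where it is below
  \<open>h'\<close>. Beyond \<open>k\<close> the two agree, so the raised value is at most
  \<open>h' k\<close> and hence at most all later values of \<open>h\<close>: monotonicity
  survives.\<close>

lemma height_steps_of_le:
  assumes "h \<in> heights N" and h': "h' \<in> heights N" and "h \<le> h'"
  shows "(height_step N)\<^sup>*\<^sup>* h h'"
  using assms(1,3)
proof (induction "sum h' {1..N} - sum h {1..N}" arbitrary: h rule: less_induct)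
  case less
  note h = less.prems
  show ?case
  proof (cases "h = h'")
    case False
    define A where "A = {k. h k < h' k}"
    have sub: "A \<subseteq> {1..N}"
    proof
      fix k assume "k \<in> A"
      then have "h k < h' k" by (simp add: A_def)
      moreover have "h k = h' k" if "k > N" using that h(1) h' by (simp add: heights_def)
      moreover have "h k = h' k" if "k = 0" using that heights_0[OF h(1)] heights_0[OF h'] by simp
      ultimately show "k \<in> {1..N}" by fastforce
    qed
    have "A \<noteq> {}"
    proof
      assume "A = {}"
      then have "h' \<le> h" by (simp add: A_def le_fun_def not_less)
      then show False using False h(2) by simp
    qed
    define k where "k = Max A"
    have fin: "finite A" using sub by (rule finite_subset) simp
    have k: "k \<in> A" "\<And>j. j \<in> A \<Longrightarrow> j \<le> k"
      unfolding k_def using fin \<open>A \<noteq> {}\<close> by simp_all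
    have k1N: "k \<in> {1..N}" using k(1) sub by blast
    have up: "h j = h' j" if "j > k" for j
    proof (rule ccontr)
      assume "h j \<noteq> h' j"
      then have "j \<in> A" using le_funD[OF h(2), of j] by (simp add: A_def)
      then show False using k(2)[of j] that by simp
    qed
    have kk: "h k < h' k" using k(1) by (simp add: A_def)
    define g where "g = h(k := Suc (h k))"
    have "mono g"
    proof (rule monoI)
      fix i j :: nat assume ij: "i \<le> j"
      have "h i \<le> h j" "h' i \<le> h' j" using ij h(1) h' by (auto simp: heights_def mono_def)
      then show "g i \<le> g j"
        using kk up[of j] ij by (cases "j > k") (auto simp: g_def)
    qed
    moreover have "g j \<le> j" for j
    proof -
      have "h j \<le> j" "h' j \<le> j" using h(1) h' by (auto simp: heights_def)
      then show ?thesis using kk by (auto simp: g_def)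
    qed
    moreover have "g j = j" if "j > N" for j
      using that h(1) k1N by (auto simp: heights_def g_def)
    ultimately have g: "g \<in> heights N" by (simp add: heights_def)
    have step: "height_step N h g"
      using h(1) g k1N by (auto simp: height_step_def g_def)
    have le: "g \<le> h'"
      using h(2) kk by (auto simp: g_def le_fun_def)
    have "sum g {1..N} \<le> sum h' {1..N}"
      using le by (intro sum_mono) (simp add: le_fun_def)
    then have "sum h' {1..N} - sum g {1..N} < sum h' {1..N} - sum h {1..N}"
      using height_step_sum[OF step] by simp
    then show ?thesis
      using less.hyps[OF _ g le] step by (meson converse_rtranclp_into_rtranclp)
  qed simp
qed

section \<open>Covers of the zigzag snake graph\<close>

text \<open>The lower left corners of \<open>T\<^sub>1, T\<^sub>2, \<dots>\<close> form a path, the spine, and \<open>T\<^sub>k\<close> has the vertices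
  \<open>k\<close>, \<open>k + 1\<close>, \<open>k + 2\<close> of the spine and one further vertex, its tip.  Odd and even tiles are mirror
  images in this description; the label \<open>k\<close> sits on spine vertex \<open>k\<close> and on the tip of \<open>T\<^sub>k\<close>.\<close>

definition tip :: "nat \<Rightarrow> point" where
  "tip k = (if odd k then (k div 2 + 1, k div 2) else (k div 2 - 1, k div 2 + 1))"

text \<open>Around \<open>T_k\<close> the sides are, in cyclic order, \<open>base_edge k\<close>,
  \<open>f_edge k\<close>, \<open>spine_edge (Suc k)\<close>, \<open>spine_edge k\<close>.
  Consecutive tiles \<open>T_k\<close> and \<open>T_(k+1)\<close> share
  \<open>spine_edge (Suc k)\<close>.\<close>

definition spine_edge :: "nat \<Rightarrow> point set" where
  "spine_edge k = {tile_corner k, tile_corner (Suc k)}"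

definition base_edge :: "nat \<Rightarrow> point set" where
  "base_edge k = {tile_corner k, tip k}"

lemma tile_vertices:
  assumes "k \<ge> 1"
  shows "bottom_left k = tile_corner k"
    and "bottom_right k = (if odd k then tip k else tile_corner (Suc k))"
    and "top_right k = tile_corner (k + 2)"
    and "top_left k = (if odd k then tile_corner (Suc k) else tip k)"
  using assms
  by (auto simp: bottom_left_def bottom_right_def top_right_def top_left_def tile_corner_def tip_def
      elim!: oddE evenE)

lemma tile_corner_eq_iff [simp]:
  assumes "k \<ge> 1" "l \<ge> 1"
  shows "tile_corner k = tile_corner l \<longleftrightarrow> k = l"
proof -
  \<comment> \<open>Each step along the spine raises the coordinate sum by one.\<close>
  have "fst (tile_corner m) + snd (tile_corner m) = m - 1" if "m \<ge> 1" for m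
    using that by (auto simp: tile_corner_def elim!: oddE evenE)
  then show ?thesis using assms
    by (metis Suc_diff_1 Suc_le_eq One_nat_def)
qed

lemma tip_eq_iff [simp]:
  assumes "k \<ge> 1" "l \<ge> 1"
  shows "tip k = tip l \<longleftrightarrow> k = l"
proof -
  have "fst (tip m) + snd (tip m) = m" if "m \<ge> 1" for m
    using that by (auto simp: tip_def elim!: oddE evenE)
  then show ?thesis using assms by metis
qed

text \<open>The spine lies on the diagonals \<open>y - x = 0\<close> and \<open>y - x = 1\<close>,
  the tips on \<open>y - x = -1\<close> and \<open>y - x = 2\<close>.\<close>

lemma tile_corner_neq_tip [simp]:
  assumes "k \<ge> 1" "l \<ge> 1"
  shows "tile_corner k \<noteq> tip l" "tip l \<noteq> tile_corner k"
proof -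
  have "snd (tile_corner k) = fst (tile_corner k) \<or> snd (tile_corner k) = fst (tile_corner k) + 1"
    using assms(1) by (auto simp: tile_corner_def elim!: oddE evenE)
  moreover have "fst (tip l) = snd (tip l) + 1 \<or> snd (tip l) = fst (tip l) + 2"
    using assms(2) by (auto simp: tip_def elim!: oddE evenE)
  ultimately show "tile_corner k \<noteq> tip l" 
    by (cases "tile_corner k"; cases "tip l") auto
  then show "tip l \<noteq> tile_corner k" by simp
qed

lemma f_edge_eq: "k \<ge> 1 \<Longrightarrow> f_edge k = {tip k, tile_corner (k + 2)}"
  by (simp add: f_edge_def tile_vertices)

lemma tile_boundary_eq:
  assumes "k \<ge> 1"
  shows "tile_boundary k =
    (if odd k
     then {(tile_corner k, tip k), (tip k, tile_corner (k + 2)),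
       (tile_corner (k + 2), tile_corner (Suc k)), (tile_corner (Suc k), tile_corner k)}
     else {(tip k, tile_corner k), (tile_corner (k + 2), tip k),
       (tile_corner (Suc k), tile_corner (k + 2)), (tile_corner k, tile_corner (Suc k))})"
  using assms by (auto simp: tile_boundary_def tile_vertices)

section \<open>Edges, vertices and labels of the snake graph\<close>

lemma snake_edges_eq:
  assumes "N \<ge> 1"
  shows "snake_edges N = spine_edge ` {1..N + 1} \<union> base_edge ` {1..N} \<union> f_edge ` {1..N}"
proof -
  have tile: "{{u, v} | u v. (u, v) \<in> tile_boundary k} =
      {spine_edge k, spine_edge (Suc k), base_edge k, f_edge k}" if "k \<ge> 1" for k
  proof -
    have "{{u, v} | u v. (u, v) \<in> tile_boundary k} = (\<lambda>(u, v). {u, v}) ` tile_boundary k"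
      by auto
    then show ?thesis
      using that
      by (auto simp: tile_boundary_eq f_edge_eq spine_edge_def base_edge_def insert_commute)
  qed
  have "snake_edges N = (\<Union>k\<in>{1..N}. {spine_edge k, spine_edge (Suc k), base_edge k, f_edge k})"
    unfolding snake_edges_def by (intro SUP_cong refl tile) auto
  also have "\<dots> = spine_edge ` ({1..N} \<union> Suc ` {1..N}) \<union> base_edge ` {1..N} \<union> f_edge ` {1..N}"
    by blast
  also have "{1..N} \<union> Suc ` {1..N} = {1..N + 1}"
    using assms by (auto simp: image_Suc_atLeastAtMost)
  finally show ?thesis .
qed

lemma snake_vertices_eq:
  assumes "N \<ge> 1"
  shows "snake_vertices N = tile_corner ` {1..N + 2} \<union> tip ` {1..N}"
proof -
  have "snake_vertices N =
      (\<Union>k\<in>{1..N}. {tile_corner k, tile_corner (Suc k), tile_corner (Suc (Suc k)), tip k})"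
    unfolding snake_vertices_def by (intro SUP_cong refl) (auto simp: tile_vertices)
  also have "\<dots> = tile_corner ` ({1..N} \<union> Suc ` {1..N} \<union> Suc ` Suc ` {1..N}) \<union> tip ` {1..N}"
    by blast
  also have "{1..N} \<union> Suc ` {1..N} \<union> Suc ` Suc ` {1..N} = {1..N + 2}"
    using assms by (auto simp: image_Suc_atLeastAtMost)
  finally show ?thesis .
qed

lemma labeled_vertices_eq: "k \<ge> 1 \<Longrightarrow> labeled_vertices k = {tile_corner k, tip k}"
  by (auto simp: labeled_vertices_def tile_vertices)

lemma standard_label_eqI:
  assumes "k \<in> {1..N}" "v \<in> labeled_vertices k"
  shows "standard_label N v = k"
proof -
  have "(THE k. k \<in> {1..N} \<and> v \<in> labeled_vertices k) = k"
    using assms labeled_vertices_disjoint[of _ k v] by (intro the_equality) auto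
  then show ?thesis using assms by (auto simp: standard_label_def)
qed

lemma standard_label_tip: "k \<in> {1..N} \<Longrightarrow> standard_label N (tip k) = k"
  by (intro standard_label_eqI) (auto simp: labeled_vertices_eq)

text \<open>The two vertices outside all labeled pairs are the spine vertices \<open>N + 1\<close>
  and \<open>N + 2\<close>; the minimum gives both the label \<open>N + 1\<close>.\<close>

lemma standard_label_tile_corner:
  assumes "k \<in> {1..N + 2}"
  shows "standard_label N (tile_corner k) = min k (N + 1)"
proof (cases "k \<le> N")
  case True
  then show ?thesis
    using assms standard_label_eqI[of k N "tile_corner k"] by (auto simp: labeled_vertices_eq)
next
  case False
  then have "\<not> (\<exists>l\<in>{1..N}. tile_corner k \<in> labeled_vertices l)"
    using assms by (auto simp: labeled_vertices_eq)
  then have "standard_label N (tile_corner k) = N + 1"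
    unfolding standard_label_def by simp
  then show ?thesis using False by simp
qed

lemma inj_on_edges:
  "inj_on spine_edge {1..}" "inj_on base_edge {1..}" "inj_on f_edge {1..}"
  by (auto simp: inj_on_def spine_edge_def base_edge_def f_edge_eq doubleton_eq_iff)

lemma edges_distinct:
  assumes "k \<ge> 1" "l \<ge> 1"
  shows "spine_edge k \<noteq> base_edge l" "spine_edge k \<noteq> f_edge l" "base_edge k \<noteq> f_edge l"
  using assms by (auto simp: spine_edge_def base_edge_def f_edge_eq doubleton_eq_iff)

lemma edge_eq_iff:
  assumes "k \<ge> 1" "l \<ge> 1"
  shows "spine_edge k = spine_edge l \<longleftrightarrow> k = l"
    and "base_edge k = base_edge l \<longleftrightarrow> k = l"
    and "f_edge k = f_edge l \<longleftrightarrow> k = l"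
  using assms inj_on_edges by (auto simp: inj_on_eq_iff)

lemma sum_snake_edges:
  fixes g :: "point set \<Rightarrow> nat"
  assumes "N \<ge> 1"
  shows "(\<Sum>e\<in>snake_edges N. g e) =
    (\<Sum>k\<in>{1..N + 1}. g (spine_edge k)) + (\<Sum>k\<in>{1..N}. g (base_edge k)) + (\<Sum>k\<in>{1..N}. g (f_edge k))"
proof -
  have inj: "inj_on spine_edge {1..N + 1}" "inj_on base_edge {1..N}" "inj_on f_edge {1..N}"
    by (rule inj_on_subset[OF inj_on_edges(1)] inj_on_subset[OF inj_on_edges(2)]
        inj_on_subset[OF inj_on_edges(3)]; auto)+
  have disj: "spine_edge ` {1..N + 1} \<inter> base_edge ` {1..N} = {}"
    "(spine_edge ` {1..N + 1} \<union> base_edge ` {1..N}) \<inter> f_edge ` {1..N} = {}"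
    by (auto simp: edges_distinct edges_distinct[symmetric])
  show ?thesis
    unfolding snake_edges_eq[OF assms]
    using sum.reindex[OF inj(1), of g] sum.reindex[OF inj(2), of g] sum.reindex[OF inj(3), of g]
    by (simp only: sum.union_disjoint[OF _ _ disj(1)] sum.union_disjoint[OF _ _ disj(2)]
        finite_UnI finite_imageI finite_atLeastAtMost o_def)
qed

lemma finite_snake_edges: "N \<ge> 1 \<Longrightarrow> finite (snake_edges N)"
  by (simp add: snake_edges_eq)

section \<open>Sums of multiplicities around a vertex\<close>

lemma star_sum_tip:
  fixes \<omega> :: "point set \<Rightarrow> nat"
  assumes k: "k \<in> {1..N}"
  shows "(\<Sum>e\<in>{e \<in> snake_edges N. tip k \<in> e}. \<omega> e) = \<omega> (base_edge k) + \<omega> (f_edge k)"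
proof -
  have N: "N \<ge> 1" using k by simp
  have "(\<Sum>e\<in>{e \<in> snake_edges N. tip k \<in> e}. \<omega> e) =
      (\<Sum>e\<in>snake_edges N. if tip k \<in> e then \<omega> e else 0)"
    by (rule sum.inter_filter[OF finite_snake_edges[OF N]])
  also have "\<dots> = (\<Sum>j\<in>{1..N + 1}. 0) + (\<Sum>j\<in>{1..N}. if j = k then \<omega> (base_edge j) else 0) +
      (\<Sum>j\<in>{1..N}. if j = k then \<omega> (f_edge j) else 0)"
    unfolding sum_snake_edges[OF N]
    using k by (intro arg_cong2[of _ _ _ _ "(+)"] sum.cong refl)
      (auto simp: spine_edge_def base_edge_def f_edge_eq)
  finally show ?thesis using k by simp
qed

lemma star_sum_tile_corner:
  fixes \<omega> :: "point set \<Rightarrow> nat"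
  assumes N: "N \<ge> 1" and k: "k \<in> {1..N + 2}"
  shows "(\<Sum>e\<in>{e \<in> snake_edges N. tile_corner k \<in> e}. \<omega> e) =
    (if k \<le> N + 1 then \<omega> (spine_edge k) else 0) + (if k \<ge> 2 then \<omega> (spine_edge (k - 1)) else 0) +
    (if k \<le> N then \<omega> (base_edge k) else 0) + (if k \<ge> 3 then \<omega> (f_edge (k - 2)) else 0)"
proof -
  have "(\<Sum>e\<in>{e \<in> snake_edges N. tile_corner k \<in> e}. \<omega> e) =
      (\<Sum>e\<in>snake_edges N. if tile_corner k \<in> e then \<omega> e else 0)"
    by (rule sum.inter_filter[OF finite_snake_edges[OF N]])
  \<comment> \<open>For small \<open>k\<close> the truncated differences \<open>k - 1\<close> and
    \<open>k - 2\<close> are 0, outside the range of \<open>j\<close>, so the absent edges drop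
    out.\<close>
  also have "\<dots> =
      (\<Sum>j\<in>{1..N + 1}. (if j = k then \<omega> (spine_edge j) else 0) + (if j = k - 1 then \<omega> (spine_edge j) else 0)) +
      (\<Sum>j\<in>{1..N}. if j = k then \<omega> (base_edge j) else 0) +
      (\<Sum>j\<in>{1..N}. if j = k - 2 then \<omega> (f_edge j) else 0)"
    unfolding sum_snake_edges[OF N]
    using k by (intro arg_cong2[of _ _ _ _ "(+)"] sum.cong refl)
      (auto simp: spine_edge_def base_edge_def f_edge_eq)
  finally show ?thesis using k by (auto simp: sum.distrib)
qed

section \<open>Covers as height sequences\<close>

text \<open>Extending the heights by \<open>h 0 = 0\<close> and \<open>h (N + 1) = N + 1\<close> makes the vertex conditions
  uniform, including the two vertices labeled \<open>N + 1\<close> and the first tile.\<close>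

definition cover_height :: "nat \<Rightarrow> (point set \<Rightarrow> nat) \<Rightarrow> nat \<Rightarrow> nat" where
  "cover_height N \<omega> k = (if k \<in> {1..N} then \<omega> (f_edge k) else k)"

text \<open>The conditions at the tips determine the base edges. At spine vertex \<open>k\<close>,
  inserting the equation for \<open>spine_edge (k - 1)\<close> and the one for
  \<open>base_edge k\<close> leaves the equation for \<open>spine_edge k\<close>. All equations are
  additive, which avoids truncated subtraction.\<close>

lemma zigzag_covers_iff:
  assumes N: "N \<ge> 1"
  defines "H \<equiv> cover_height N"
  shows "\<omega> \<in> zigzag_covers N \<longleftrightarrow> \<omega> \<in> extensional (snake_edges N) \<and>
    (\<forall>k\<in>{1..N}. \<omega> (base_edge k) + H \<omega> k = k) \<and>
    (\<forall>k\<in>{1..N + 1}. \<omega> (spine_edge k) + H \<omega> (k - 1) = H \<omega> k)"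
proof -
  \<comment> \<open>The term \<open>H \<omega> (k - 2)\<close> replaces the multiplicity of
    \<open>f_edge (k - 2)\<close>; it vanishes for \<open>k \<le> 2\<close> because
    \<open>H \<omega> 0 = 0\<close>.\<close>
  define star where "star k = (if k \<le> N + 1 then \<omega> (spine_edge k) else 0) +
    (if k \<ge> 2 then \<omega> (spine_edge (k - 1)) else 0) + (if k \<le> N then \<omega> (base_edge k) else 0) + H \<omega> (k - 2)" for k
  have corner: "(\<Sum>e\<in>{e \<in> snake_edges N. tile_corner k \<in> e}. \<omega> e) = star k"
    if "k \<in> {1..N + 2}" for k
    unfolding star_sum_tile_corner[OF N that]
    using that by (auto simp: star_def H_def cover_height_def)
  have "\<omega> \<in> zigzag_covers N \<longleftrightarrow> \<omega> \<in> extensional (snake_edges N) \<and>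
    (\<forall>k\<in>{1..N}. \<omega> (base_edge k) + H \<omega> k = k) \<and> (\<forall>k\<in>{1..N + 2}. star k = min k (N + 1))"
    using corner standard_label_tile_corner star_sum_tip standard_label_tip
    by (auto simp: zigzag_covers_def mixed_dimer_covers_def snake_vertices_eq[OF N] ball_Un PiE_def
        H_def cover_height_def simp del: atLeastAtMost_iff intro!: ballI)
  also have "\<dots> \<longleftrightarrow> \<omega> \<in> extensional (snake_edges N) \<and>
    (\<forall>k\<in>{1..N}. \<omega> (base_edge k) + H \<omega> k = k) \<and>
    (\<forall>k\<in>{1..N + 1}. \<omega> (spine_edge k) + H \<omega> (k - 1) = H \<omega> k)"
  proof (intro conj_cong refl)
    assume base: "\<forall>k\<in>{1..N}. \<omega> (base_edge k) + H \<omega> k = k"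
    have H0: "H \<omega> 0 = 0" and HN: "H \<omega> (Suc N) = Suc N"
      by (auto simp: H_def cover_height_def)
    have star: "star k = min k (N + 1) \<longleftrightarrow> \<omega> (spine_edge k) + H \<omega> (k - 1) = H \<omega> k"
      if k: "k \<in> {1..N + 1}" and prev: "k \<ge> 2 \<Longrightarrow> \<omega> (spine_edge (k - 1)) + H \<omega> (k - 2) = H \<omega> (k - 1)" for k
    proof -
      have "star k = \<omega> (spine_edge k) + H \<omega> (k - 1) + (if k \<le> N then \<omega> (base_edge k) else 0)"
        using k prev H0 by (cases "k \<ge> 2") (auto simp: star_def)
      moreover have "\<omega> (base_edge k) + H \<omega> k = k" if "k \<le> N" using base that k by auto
      moreover have "k = Suc N" if "\<not> k \<le> N" using that k by auto
      ultimately show ?thesis using HN k by (cases "k \<le> N") auto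
    qed
    show "(\<forall>k\<in>{1..N + 2}. star k = min k (N + 1)) \<longleftrightarrow>
        (\<forall>k\<in>{1..N + 1}. \<omega> (spine_edge k) + H \<omega> (k - 1) = H \<omega> k)" (is "?l \<longleftrightarrow> ?r")
    proof
      assume l: ?l
      have "k \<in> {1..N + 1} \<Longrightarrow> \<omega> (spine_edge k) + H \<omega> (k - 1) = H \<omega> k" for k
      proof (induction k)
        case (Suc k)
        then show ?case using l star[of "Suc k"] by (cases "k = 0") auto
      qed simp
      then show ?r by blast
    next
      assume r: ?r
      have "star k = min k (N + 1)" if "k \<in> {1..N + 1}" for k
      proof -
        have "\<omega> (spine_edge (k - 1)) + H \<omega> (k - 2) = H \<omega> (k - 1)" if "k \<ge> 2"
          using bspec[OF r, of "k - 1"] \<open>k \<in> {1..N + 1}\<close> that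
          by (cases k) (auto simp: numeral_2_eq_2)
        then show ?thesis using r star that by blast
      qed
      \<comment> \<open>At the last vertex only \<open>spine_edge (N + 1)\<close> and
        \<open>f_edge N\<close> meet, and their sum is fixed by the equation for
        \<open>spine_edge (N + 1)\<close>.\<close>
      moreover have "star (N + 2) = N + 1"
        using bspec[OF r, of "Suc N"] HN by (simp add: star_def)
      moreover have "k \<in> {1..N + 1} \<or> k = N + 2" if "k \<in> {1..N + 2}" for k using that by auto
      ultimately show ?l by fastforce
    qed
  qed
  finally show ?thesis .
qed

text \<open>Nonnegativity of the spine multiplicities is monotonicity of the heights; nonnegativity
  of the base multiplicities is the bound by \<open>k\<close>.\<close>

lemma cover_height_in_heights:
  assumes N: "N \<ge> 1" and \<omega>: "\<omega> \<in> zigzag_covers N"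
  shows "cover_height N \<omega> \<in> heights N"
proof -
  let ?H = "cover_height N \<omega>"
  have eqs: "\<And>k. k \<in> {1..N} \<Longrightarrow> \<omega> (base_edge k) + ?H k = k"
    "\<And>k. k \<in> {1..N + 1} \<Longrightarrow> \<omega> (spine_edge k) + ?H (k - 1) = ?H k"
    using \<omega> zigzag_covers_iff[OF N] by auto
  have "?H k \<le> ?H (Suc k)" for k
  proof (cases "k \<le> N")
    case True
    then show ?thesis using eqs(2)[of "Suc k"] by simp
  qed (simp add: cover_height_def)
  then have "mono ?H" by (simp add: mono_iff_le_Suc)
  moreover have "?H k \<le> k" for k
  proof (cases "k \<in> {1..N}")
    case True
    then show ?thesis using eqs(1)[of k] by simp
  qed (simp add: cover_height_def del: atLeastAtMost_iff)
  ultimately show ?thesis by (simp add: heights_def cover_height_def)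
qed

lemma bij_betw_cover_height:
  assumes N: "N \<ge> 1"
  shows "bij_betw (cover_height N) (zigzag_covers N) (heights N)"
proof (rule bij_betw_imageI)
  show "inj_on (cover_height N) (zigzag_covers N)"
  proof (rule inj_onI)
    fix \<omega> \<omega>' assume cov: "\<omega> \<in> zigzag_covers N" "\<omega>' \<in> zigzag_covers N"
      and H: "cover_height N \<omega> = cover_height N \<omega>'"
    note c = cov[unfolded zigzag_covers_iff[OF N]]
    show "\<omega> = \<omega>'"
    proof (rule extensionalityI)
      fix e assume "e \<in> snake_edges N"
      then consider k where "k \<in> {1..N + 1}" "e = spine_edge k" | k where "k \<in> {1..N}" "e = base_edge k"
        | k where "k \<in> {1..N}" "e = f_edge k"
        unfolding snake_edges_eq[OF N] by blast
      then show "\<omega> e = \<omega>' e"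
      proof cases
        case 1
        then show ?thesis using c H by (metis add_right_cancel)
      next
        case 2
        then show ?thesis using c H by (metis add_right_cancel)
      next
        case 3
        then show ?thesis using fun_cong[OF H, of k] by (simp add: cover_height_def)
      qed
    qed (use c in auto)
  qed
next
  have "\<exists>\<omega>\<in>zigzag_covers N. cover_height N \<omega> = h" if h: "h \<in> heights N" for h
  proof -
    \<comment> \<open>\<open>inv_into\<close> recovers the index of an edge within its family. The
      families are disjoint, and the value \<open>undefined\<close> elsewhere makes the function
      extensional. Monotonicity and the bound by \<open>k\<close> make the subtractions
      exact.\<close>
    define \<omega> where "\<omega> e =
      (if e \<in> spine_edge ` {1..N + 1}
       then h (inv_into {1..} spine_edge e) - h (inv_into {1..} spine_edge e - 1)
       else if e \<in> base_edge ` {1..N} then inv_into {1..} base_edge e - h (inv_into {1..} base_edge e)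
       else if e \<in> f_edge ` {1..N} then h (inv_into {1..} f_edge e) else undefined)" for e
    have spine: "\<omega> (spine_edge k) = h k - h (k - 1)" if "k \<in> {1..N + 1}" for k
      using that inv_into_f_f[OF inj_on_edges(1), of k] by (simp add: \<omega>_def)
    have base: "\<omega> (base_edge k) = k - h k" if "k \<in> {1..N}" for k
    proof -
      have "base_edge k \<notin> spine_edge ` {1..N + 1}"
        using that by (auto simp: edges_distinct edges_distinct[symmetric])
      then show ?thesis
        using that inv_into_f_f[OF inj_on_edges(2), of k] by (simp add: \<omega>_def)
    qed
    have f: "\<omega> (f_edge k) = h k" if "k \<in> {1..N}" for k
    proof -
      have "f_edge k \<notin> spine_edge ` {1..N + 1}" "f_edge k \<notin> base_edge ` {1..N}"
        using that by (auto simp: edges_distinct edges_distinct[symmetric])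
      then show ?thesis
        using that inv_into_f_f[OF inj_on_edges(3), of k] by (simp add: \<omega>_def)
    qed
    have H: "cover_height N \<omega> = h"
    proof
      fix k show "cover_height N \<omega> k = h k"
        using f[of k] h heights_0[OF h] by (cases "k = 0") (auto simp: cover_height_def heights_def)
    qed
    have "\<omega> \<in> extensional (snake_edges N)"
      unfolding snake_edges_eq[OF N] by (auto simp: extensional_def \<omega>_def)
    moreover have "\<omega> (base_edge k) + h k = k" if "k \<in> {1..N}" for k
      using base[OF that] h by (simp add: heights_def)
    moreover have "\<omega> (spine_edge k) + h (k - 1) = h k" if "k \<in> {1..N + 1}" for k
    proof -
      have "h (k - 1) \<le> h k" using h by (simp add: heights_def mono_def)
      then show ?thesis using spine[OF that] by simp
    qed
    ultimately have "\<omega> \<in> zigzag_covers N"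
      using H by (simp add: zigzag_covers_iff[OF N])
    then show ?thesis using H by blast
  qed
  then show "cover_height N ` zigzag_covers N = heights N"
    using cover_height_in_heights[OF N] by blast
qed

section \<open>Colors and face twists\<close>

text \<open>Colors alternate along the spine, and the prescribed black vertex fixes the phase: it is
  \<open>tip N\<close> for odd \<open>N\<close> and spine vertex \<open>N + 2\<close> for even
  \<open>N\<close>.\<close>

lemma snake_coloring_vertices:
  assumes N: "N \<ge> 1" and col: "snake_coloring N black"
  shows "k \<in> {1..N + 2} \<Longrightarrow> black (tile_corner k) \<longleftrightarrow> even k"
    and "k \<in> {1..N} \<Longrightarrow> black (tip k) \<longleftrightarrow> odd k"
proof -
  have edge: "black u \<noteq> black v" if "{u, v} \<in> snake_edges N" for u v
    using col that unfolding snake_coloring_def proper_2_coloring_def by blast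
  have spine: "black (tile_corner k) \<noteq> black (tile_corner (Suc k))" if "k \<in> {1..N + 1}" for k
    using that by (intro edge) (auto simp: snake_edges_eq[OF N] spine_edge_def)
  have base: "black (tile_corner k) \<noteq> black (tip k)" if "k \<in> {1..N}" for k
    using that by (intro edge) (auto simp: snake_edges_eq[OF N] base_edge_def)
  have chain: "k \<in> {1..N + 2} \<Longrightarrow> (black (tile_corner k) \<longleftrightarrow> even k) \<longleftrightarrow> \<not> black (tile_corner 1)" for k
  proof (induction k)
    case (Suc k)
    then show ?case using spine[of k] by (cases "k = 0") auto
  qed simp
  have "\<exists>m\<in>{1..N + 2}. black (tile_corner m) \<longleftrightarrow> even m"
  proof (cases "odd N")
    case True
    then have "black (tip N)" using col N by (simp add: snake_coloring_def tile_vertices)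
    then show ?thesis using True base[of N] N by (intro bexI[of _ N]) auto
  next
    case False
    then have "black (tile_corner (N + 2))" using col N by (simp add: snake_coloring_def tile_vertices)
    then show ?thesis using False by (intro bexI[of _ "N + 2"]) auto
  qed
  then show corner: "k \<in> {1..N + 2} \<Longrightarrow> black (tile_corner k) \<longleftrightarrow> even k" for k
    using chain by blast
  show "k \<in> {1..N} \<Longrightarrow> black (tip k) \<longleftrightarrow> odd k"
    using corner[of k] base[of k] by auto
qed

text \<open>From odd to even tiles both the orientation of the boundary and the colors are reversed.
  The two changes cancel, so the answer does not depend on the parity of \<open>k\<close>.\<close>

lemma twist_edges_eq:
  assumes N: "N \<ge> 1" and col: "snake_coloring N black" and k: "k \<in> {1..N}"
  shows "odd_edges black k = {base_edge k, spine_edge (Suc k)}"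
    and "even_edges black k = {f_edge k, spine_edge k}"
proof -
  have colors: "black (tile_corner k) \<longleftrightarrow> even k" "black (tile_corner (Suc k)) \<longleftrightarrow> odd k"
    "black (tile_corner (Suc (Suc k))) \<longleftrightarrow> even k" "black (tip k) \<longleftrightarrow> odd k"
    using snake_coloring_vertices[OF N col] k by auto
  have "odd_edges black k = (\<lambda>(u, v). {u, v}) ` {(u, v) \<in> tile_boundary k. \<not> black u \<and> black v}"
    by (auto simp: odd_edges_def)
  also have "{(u, v) \<in> tile_boundary k. \<not> black u \<and> black v} =
      (if odd k then {(tile_corner k, tip k), (tile_corner (k + 2), tile_corner (Suc k))}
       else {(tip k, tile_corner k), (tile_corner (Suc k), tile_corner (k + 2))})"
    using k colors by (auto simp: tile_boundary_eq)
  finally show "odd_edges black k = {base_edge k, spine_edge (Suc k)}"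
    by (auto simp: base_edge_def spine_edge_def insert_commute)
  have "even_edges black k = (\<lambda>(u, v). {u, v}) ` {(u, v) \<in> tile_boundary k. black u \<and> \<not> black v}"
    by (auto simp: even_edges_def)
  also have "{(u, v) \<in> tile_boundary k. black u \<and> \<not> black v} =
      (if odd k then {(tip k, tile_corner (k + 2)), (tile_corner (Suc k), tile_corner k)}
       else {(tile_corner (k + 2), tip k), (tile_corner k, tile_corner (Suc k))})"
    using k colors by (auto simp: tile_boundary_eq)
  finally show "even_edges black k = {f_edge k, spine_edge k}"
    using k by (auto simp: f_edge_eq spine_edge_def insert_commute)
qed

text \<open>Among the f-edges a twist of \<open>T_k\<close> changes only \<open>f_edge k\<close>.
  Conversely, the cover equations turn the raised height into the changes on all four sides; the odd
  edges of \<open>\<omega>\<close> are positive because \<open>\<omega>'\<close> has one less there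
  and is still nonnegative.\<close>

lemma twist_step_iff_height_step:
  assumes N: "N \<ge> 1" and col: "snake_coloring N black"
    and cov: "\<omega> \<in> zigzag_covers N" "\<omega>' \<in> zigzag_covers N"
  shows "twist_step N black \<omega> \<omega>' \<longleftrightarrow> height_step N (cover_height N \<omega>) (cover_height N \<omega>')"
proof -
  let ?h = "cover_height N \<omega>" and ?h' = "cover_height N \<omega>'"
  note c = cov[unfolded zigzag_covers_iff[OF N]]
  have "positive_face_twist black k \<omega> \<omega>' \<longleftrightarrow> ?h' = ?h(k := Suc (?h k))" if k: "k \<in> {1..N}" for k
  proof
    assume "positive_face_twist black k \<omega> \<omega>'"
    then have \<omega>': "\<omega>' = (\<lambda>e. if e \<in> {base_edge k, spine_edge (Suc k)} then \<omega> e - 1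
        else if e \<in> {f_edge k, spine_edge k} then \<omega> e + 1 else \<omega> e)"
      unfolding positive_face_twist_def twist_edges_eq[OF N col k] by blast
    have "\<omega>' (f_edge j) = (if j = k then Suc (\<omega> (f_edge j)) else \<omega> (f_edge j))" if "j \<in> {1..N}" for j
      using that k by (auto simp: \<omega>' edges_distinct edges_distinct[symmetric] edge_eq_iff)
    then show "?h' = ?h(k := Suc (?h k))"
      using k by (auto simp: cover_height_def fun_eq_iff)
  next
    assume h': "?h' = ?h(k := Suc (?h k))"
    have base: "\<omega> (base_edge j) = (if j = k then Suc (\<omega>' (base_edge j)) else \<omega>' (base_edge j))"
      if "j \<in> {1..N}" for j
    proof -
      have "\<omega> (base_edge j) + ?h j = j" "\<omega>' (base_edge j) + ?h' j = j" using c that by auto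
      then show ?thesis by (simp add: h' split: if_splits)
    qed
    have spine: "\<omega>' (spine_edge j) =
        (if j = k then Suc (\<omega> (spine_edge j)) else if j = Suc k then \<omega> (spine_edge j) - 1 else \<omega> (spine_edge j))"
      "j = Suc k \<Longrightarrow> \<omega> (spine_edge j) > 0"
      if "j \<in> {1..N + 1}" for j
    proof -
      have "\<omega> (spine_edge j) + ?h (j - 1) = ?h j" "\<omega>' (spine_edge j) + ?h' (j - 1) = ?h' j"
        using c that by auto
      moreover have "j - 1 = k \<longleftrightarrow> j = Suc k" using that by auto
      ultimately show "\<omega>' (spine_edge j) =
        (if j = k then Suc (\<omega> (spine_edge j)) else if j = Suc k then \<omega> (spine_edge j) - 1 else \<omega> (spine_edge j))"
        "j = Suc k \<Longrightarrow> \<omega> (spine_edge j) > 0"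
        by (auto simp: h' split: if_splits)
    qed
    have f: "\<omega>' (f_edge j) = (if j = k then Suc (\<omega> (f_edge j)) else \<omega> (f_edge j))" if "j \<in> {1..N}" for j
      using fun_cong[OF h', of j] that k by (auto simp: cover_height_def split: if_splits)
    have edges: "base_edge k \<in> snake_edges N" "spine_edge (Suc k) \<in> snake_edges N"
        "f_edge k \<in> snake_edges N" "spine_edge k \<in> snake_edges N"
      using k by (auto simp: snake_edges_eq[OF N])
    have "\<omega>' e = (if e \<in> {base_edge k, spine_edge (Suc k)} then \<omega> e - 1
        else if e \<in> {f_edge k, spine_edge k} then \<omega> e + 1 else \<omega> e)" for e
    proof (cases "e \<in> snake_edges N")
      case True
      then consider j where "j \<in> {1..N + 1}" "e = spine_edge j" | j where "j \<in> {1..N}" "e = base_edge j"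
        | j where "j \<in> {1..N}" "e = f_edge j"
        unfolding snake_edges_eq[OF N] by blast
      then show ?thesis
      proof cases
        case 1
        then show ?thesis using k spine(1)[of j]
          by (simp add: edges_distinct edge_eq_iff)
      next
        case 2
        then show ?thesis using k base[of j]
          by (cases "j = k") (simp_all add: edges_distinct edges_distinct[symmetric] edge_eq_iff)
      next
        case 3
        then show ?thesis using k f[of j]
          by (simp add: edges_distinct edges_distinct[symmetric] edge_eq_iff)
      qed
    next
      case False
      \<comment> \<open>Off the edge set both covers are \<open>undefined\<close>, and the twist
        alters nothing there.\<close>
      then have "\<omega> e = \<omega>' e" using c by (simp add: extensional_def)
      then show ?thesis using False edges by auto
    qed
    then show "positive_face_twist black k \<omega> \<omega>'"
      unfolding positive_face_twist_def twist_edges_eq[OF N col k]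
      using base[OF k] spine(2)[of "Suc k"] k by auto
  qed
  then show ?thesis
    using cov cover_height_in_heights[OF N] by (simp add: twist_step_def height_step_def)
qed

text \<open>Intermediate height sequences lift to covers by surjectivity of
  \<open>cover_height N\<close>. The length \<open>d\<close> is kept for the sake of the
  rank.\<close>

lemma twist_steps_iff_height_steps:
  assumes N: "N \<ge> 1" and col: "snake_coloring N black"
    and cov: "\<omega> \<in> zigzag_covers N" "\<omega>' \<in> zigzag_covers N"
  shows "(twist_step N black ^^ d) \<omega> \<omega>' \<longleftrightarrow>
    (height_step N ^^ d) (cover_height N \<omega>) (cover_height N \<omega>')"
  using cov(2)
proof (induction d arbitrary: \<omega>')
  case 0
  then show ?case
    using cov(1) bij_betw_cover_height[OF N] by (auto simp: bij_betw_def inj_on_eq_iff)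
next
  case (Suc d)
  show ?case
  proof
    assume "(twist_step N black ^^ Suc d) \<omega> \<omega>'"
    then obtain \<rho> where \<rho>: "(twist_step N black ^^ d) \<omega> \<rho>" "twist_step N black \<rho> \<omega>'"
      by auto
    then have "\<rho> \<in> zigzag_covers N" by (simp add: twist_step_def)
    then show "(height_step N ^^ Suc d) (cover_height N \<omega>) (cover_height N \<omega>')"
      using \<rho> Suc twist_step_iff_height_step[OF N col] by auto
  next
    assume "(height_step N ^^ Suc d) (cover_height N \<omega>) (cover_height N \<omega>')"
    then obtain g where g: "(height_step N ^^ d) (cover_height N \<omega>) g" "height_step N g (cover_height N \<omega>')"
      by auto
    then have "g \<in> heights N" by (simp add: height_step_def)
    then obtain \<rho> where "\<rho> \<in> zigzag_covers N" "g = cover_height N \<rho>"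
      using bij_betw_cover_height[OF N] by (auto simp: bij_betw_def)
    then show "(twist_step N black ^^ Suc d) \<omega> \<omega>'"
      using g Suc twist_step_iff_height_step[OF N col] by auto
  qed
qed

section \<open>The face twist order, its minimum and its rank\<close>

lemma face_twist_order_iff:
  assumes N: "N \<ge> 1" and col: "snake_coloring N black"
    and cov: "\<omega> \<in> zigzag_covers N" "\<omega>' \<in> zigzag_covers N"
  shows "(\<omega>, \<omega>') \<in> face_twist_order N black \<longleftrightarrow> cover_height N \<omega> \<le> cover_height N \<omega>'"
proof -
  have "(\<omega>, \<omega>') \<in> face_twist_order N black \<longleftrightarrow>
      (height_step N)\<^sup>*\<^sup>* (cover_height N \<omega>) (cover_height N \<omega>')"
    using cov twist_steps_iff_height_steps[OF N col cov]
    by (simp add: face_twist_order_def rtranclp_power)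
  then show ?thesis
    using height_steps_mono height_steps_of_le cover_height_in_heights[OF N] cov by blast
qed

lemma partial_order_on_face_twist_order:
  assumes N: "N \<ge> 1" and col: "snake_coloring N black"
  shows "partial_order_on (zigzag_covers N) (face_twist_order N black)"
proof -
  have "antisym (face_twist_order N black)"
  proof (rule antisymI)
    fix \<omega> \<omega>' assume o: "(\<omega>, \<omega>') \<in> face_twist_order N black" "(\<omega>', \<omega>) \<in> face_twist_order N black"
    then have cov: "\<omega> \<in> zigzag_covers N" "\<omega>' \<in> zigzag_covers N" by (auto simp: face_twist_order_def)
    then have "cover_height N \<omega> = cover_height N \<omega>'"
      using o face_twist_order_iff[OF N col] by (simp add: antisym)
    then show "\<omega> = \<omega>'"
      using cov bij_betw_cover_height[OF N] by (auto simp: bij_betw_def dest: inj_onD)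
  qed
  then show ?thesis
    by (auto simp: partial_order_on_def preorder_on_def refl_on_def trans_def face_twist_order_def)
qed

text \<open>The cover with zero heights on \<open>1..N\<close> lies below every cover; a least
  element is the only minimal one, so the definite description is well defined.\<close>

lemma minimal_cover_height:
  assumes N: "N \<ge> 1" and col: "snake_coloring N black"
  shows "minimal_cover N black \<in> zigzag_covers N"
    and "cover_height N (minimal_cover N black) = (\<lambda>k. if k \<le> N then 0 else k)"
proof -
  define z where "z = (\<lambda>k :: nat. if k \<le> N then 0 else k)"
  have "z \<in> heights N" by (auto simp: z_def heights_def mono_def)
  then obtain \<omega> where \<omega>: "\<omega> \<in> zigzag_covers N" "cover_height N \<omega> = z"
    using bij_betw_imp_surj_on[OF bij_betw_cover_height[OF N]] by (metis imageE)
  have least: "(\<omega>, \<omega>') \<in> face_twist_order N black" if "\<omega>' \<in> zigzag_covers N" for \<omega>'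
  proof -
    have "z \<le> cover_height N \<omega>'"
      by (auto simp: z_def le_fun_def cover_height_def)
    then show ?thesis using face_twist_order_iff[OF N col \<omega>(1) that] \<omega>(2) by simp
  qed
  have "antisym (face_twist_order N black)"
    using partial_order_on_face_twist_order[OF N col] by (simp add: partial_order_on_def)
  then have "minimal_cover N black = \<omega>"
    unfolding minimal_cover_def
    using \<omega>(1) least by (intro the_equality) (auto simp: face_twist_order_def dest: antisymD)
  then show "minimal_cover N black \<in> zigzag_covers N"
    "cover_height N (minimal_cover N black) = (\<lambda>k. if k \<le> N then 0 else k)"
    using \<omega> by (simp_all add: z_def)
qed

text \<open>Each twist adds one to the sum of the heights, so all chains from the minimum to
  \<open>\<omega>\<close> have the same length.\<close>

lemma twist_rank_eq:
  assumes N: "N \<ge> 1" and col: "snake_coloring N black" and cov: "\<omega> \<in> zigzag_covers N"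
  shows "twist_rank N black \<omega> = sum (cover_height N \<omega>) {1..N}"
proof -
  let ?m = "minimal_cover N black"
  note m = minimal_cover_height[OF N col]
  have zero: "sum (cover_height N ?m) {1..N} = 0" by (simp add: m(2))
  have len: "d = sum (cover_height N \<omega>) {1..N}" if "(twist_step N black ^^ d) ?m \<omega>" for d
    using that twist_steps_iff_height_steps[OF N col m(1) cov]
      height_steps_sum[of d N "cover_height N ?m" "cover_height N \<omega>"] zero by auto
  have "cover_height N ?m \<le> cover_height N \<omega>"
    unfolding m(2) by (auto simp: le_fun_def cover_height_def)
  then have "(?m, \<omega>) \<in> face_twist_order N black"
    using face_twist_order_iff[OF N col m(1) cov] by simp
  then obtain d where "(twist_step N black ^^ d) ?m \<omega>"
    by (auto simp: face_twist_order_def rtranclp_power)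
  then show ?thesis
    unfolding twist_rank_def using len by (intro Least_equality) auto
qed

section \<open>The isomorphism\<close>

lemma lehmer_code_eq_cover_code_iff:
  assumes "n \<ge> 2"
  shows "lehmer_code n \<sigma> = cover_code n \<omega> \<longleftrightarrow>
    (\<forall>i\<in>{1..n}. code_at n \<sigma> i = cover_height (n - 1) \<omega> (n - i))"
proof -
  \<comment> \<open>The appended 0 is the height at \<open>n - n = 0\<close>.\<close>
  have "cover_code n \<omega> = map (\<lambda>i. cover_height (n - 1) \<omega> (n - i)) [1..<n + 1]"
    using assms by (auto simp: cover_code_def cover_height_def)
  then show ?thesis
    by (auto simp: lehmer_code_conv simp del: upt_Suc)
qed

text \<open>Reading a code backwards turns weakly decreasing into weakly increasing and the bound
  \<open>n - i\<close> into the bound \<open>k\<close>; this supplies the preimages under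
  \<open>cover_perm n\<close>.\<close>

lemma heights_of_Cat:
  assumes "n \<ge> 1" "\<sigma> \<in> Cat n"
  shows "(\<lambda>k. if k < n then code_at n \<sigma> (n - k) else k) \<in> heights (n - 1)"
proof -
  have anti: "code_at n \<sigma> j \<le> code_at n \<sigma> i" if "1 \<le> i" "i \<le> j" "j \<le> n" for i j
    using assms(2) that avoids_132_iff_code_at_antimono[of \<sigma> n] unfolding Cat_def by blast
  have le: "code_at n \<sigma> (n - k) \<le> k" if "k < n" for k
    using code_at_le[of n \<sigma> "n - k"] that by simp
  have "mono (\<lambda>k. if k < n then code_at n \<sigma> (n - k) else k)"
  proof (rule monoI)
    fix k l :: nat assume "k \<le> l"
    then show "(if k < n then code_at n \<sigma> (n - k) else k) \<le> (if l < n then code_at n \<sigma> (n - l) else l)"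
      using anti[of "n - l" "n - k"] le[of k] by auto
  qed
  then show ?thesis
    using le assms(1) by (auto simp: heights_def)
qed

lemma avoids_132_of_heights:
  assumes "\<sigma> permutes {1..n}" "h \<in> heights N" "\<And>i. i \<in> {1..n} \<Longrightarrow> code_at n \<sigma> i = h (n - i)"
  shows "avoids_132 n \<sigma>"
proof -
  have "h (n - j) \<le> h (n - i)" if "i \<le> j" for i j
    using assms(2) that by (simp add: heights_def mono_def)
  then show ?thesis
    using assms by (auto simp: avoids_132_iff_code_at_antimono)
qed

theorem theorem10:
  fixes n :: nat and black :: "nat \<times> nat \<Rightarrow> bool"
  assumes "n \<ge> 2"
    and "snake_coloring (n - 1) black"
  shows "(\<forall>\<omega>\<in>zigzag_covers (n - 1). \<exists>!\<sigma>. \<sigma> permutes {1..n} \<and> lehmer_code n \<sigma> = cover_code n \<omega>) \<and>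
    poset_isomorphism (zigzag_covers (n - 1)) (face_twist_order (n - 1) black)
      (Cat n) (Restr (bruhat_order n) (Cat n)) (cover_perm n) \<and>
    rank_generating_function (n - 1) black = catalan_poly n"
proof -
  define N where "N = n - 1"
  have N: "N \<ge> 1" and n: "n = Suc N" and col: "snake_coloring N black"
    using assms by (auto simp: N_def)
  let ?H = "cover_height N"
  have heights: "?H \<omega> \<in> heights N" if "\<omega> \<in> zigzag_covers N" for \<omega>
    using cover_height_in_heights[OF N that] .
  have code_iff: "lehmer_code n \<sigma> = cover_code n \<omega> \<longleftrightarrow> (\<forall>i\<in>{1..n}. code_at n \<sigma> i = ?H \<omega> (n - i))" for \<sigma> \<omega>
    using lehmer_code_eq_cover_code_iff[OF assms(1)] by (simp add: N_def)
  have unique: "\<exists>!\<sigma>. \<sigma> permutes {1..n} \<and> lehmer_code n \<sigma> = cover_code n \<omega>" if "\<omega> \<in> zigzag_covers N" for \<omega>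
  proof -
    have "?H \<omega> (n - i) \<le> n - i" for i
      using heights[OF that] by (simp add: heights_def)
    then obtain \<sigma> where \<sigma>: "\<sigma> permutes {1..n}" "\<And>i. i \<in> {1..n} \<Longrightarrow> code_at n \<sigma> i = ?H \<omega> (n - i)"
      using ex_permutes_code_at[of n "\<lambda>i. ?H \<omega> (n - i)"] by blast
    show ?thesis
    proof (rule ex1I[of _ \<sigma>])
      show "\<sigma> permutes {1..n} \<and> lehmer_code n \<sigma> = cover_code n \<omega>"
        using \<sigma> by (simp add: code_iff)
    next
      fix \<tau> assume "\<tau> permutes {1..n} \<and> lehmer_code n \<tau> = cover_code n \<omega>"
      then show "\<tau> = \<sigma>"
        using \<sigma> permutes_eq_of_code_at_eq[of \<tau> n \<sigma>] by (simp add: code_iff)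
    qed
  qed
  let ?\<phi> = "cover_perm n"
  have \<phi>: "?\<phi> \<omega> permutes {1..n}" "\<And>i. i \<in> {1..n} \<Longrightarrow> code_at n (?\<phi> \<omega>) i = ?H \<omega> (n - i)"
    if "\<omega> \<in> zigzag_covers N" for \<omega>
    using theI'[OF unique[OF that]] unfolding cover_perm_def code_iff by blast+
  have \<phi>_Cat: "?\<phi> \<omega> \<in> Cat n" if "\<omega> \<in> zigzag_covers N" for \<omega>
    using avoids_132_of_heights[OF \<phi>(1)[OF that] heights[OF that] \<phi>(2)[OF that]] \<phi>(1)[OF that]
    by (simp add: Cat_def)
  have height_le: "?H \<omega> \<le> ?H \<omega>' \<longleftrightarrow> (\<forall>i\<in>{1..n}. code_at n (?\<phi> \<omega>) i \<le> code_at n (?\<phi> \<omega>') i)"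
    if cov: "\<omega> \<in> zigzag_covers N" "\<omega>' \<in> zigzag_covers N" for \<omega> \<omega>'
  proof
    assume le: "\<forall>i\<in>{1..n}. code_at n (?\<phi> \<omega>) i \<le> code_at n (?\<phi> \<omega>') i"
    show "?H \<omega> \<le> ?H \<omega>'"
    proof (rule le_funI)
      fix k show "?H \<omega> k \<le> ?H \<omega>' k"
      proof (cases "k < n")
        \<comment> \<open>Indices below \<open>n\<close> are reached as \<open>n - i\<close> with
          \<open>i\<close> in \<open>{1..n}\<close>; from \<open>n\<close> on all heights are
          pinned.\<close>
        case True
        then have "n - k \<in> {1..n}" "n - (n - k) = k" by auto
        then show ?thesis using le \<phi>(2)[OF cov(1), of "n - k"] \<phi>(2)[OF cov(2), of "n - k"] by metis
      qed (simp add: cover_height_def n)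
    qed
  qed (use cov in \<open>simp add: \<phi>(2) le_fun_def\<close>)
  have order: "(\<omega>, \<omega>') \<in> face_twist_order N black \<longleftrightarrow> (?\<phi> \<omega>, ?\<phi> \<omega>') \<in> bruhat_order n"
    if "\<omega> \<in> zigzag_covers N" "\<omega>' \<in> zigzag_covers N" for \<omega> \<omega>'
    using that face_twist_order_iff[OF N col] bruhat_order_Cat_iff \<phi>_Cat height_le by simp
  have bij: "bij_betw ?\<phi> (zigzag_covers N) (Cat n)"
  proof (rule bij_betw_imageI)
    show "inj_on ?\<phi> (zigzag_covers N)"
    proof (rule inj_onI)
      fix \<omega> \<omega>' assume cov: "\<omega> \<in> zigzag_covers N" "\<omega>' \<in> zigzag_covers N" and "?\<phi> \<omega> = ?\<phi> \<omega>'"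
      then have "?H \<omega> = ?H \<omega>'" using height_le by (simp add: order_antisym)
      then show "\<omega> = \<omega>'"
        using cov bij_betw_cover_height[OF N] by (auto simp: bij_betw_def dest: inj_onD)
    qed
    have "\<sigma> \<in> ?\<phi> ` zigzag_covers N" if \<sigma>: "\<sigma> \<in> Cat n" for \<sigma>
    proof -
      obtain \<omega> where \<omega>: "\<omega> \<in> zigzag_covers N" "?H \<omega> = (\<lambda>k. if k < n then code_at n \<sigma> (n - k) else k)"
        using heights_of_Cat[OF _ \<sigma>] bij_betw_imp_surj_on[OF bij_betw_cover_height[OF N]] assms(1)
        unfolding N_def by (metis (no_types, lifting) imageE one_le_numeral order_trans)
      have "code_at n (?\<phi> \<omega>) i = code_at n \<sigma> i" if "i \<in> {1..n}" for i
        using \<phi>(2)[OF \<omega>(1) that] that by (simp add: \<omega>(2))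
      then have "?\<phi> \<omega> = \<sigma>"
        using permutes_eq_of_code_at_eq[OF \<phi>(1)[OF \<omega>(1)]] \<sigma> by (simp add: Cat_def)
      then show ?thesis using \<omega>(1) by blast
    qed
    then show "?\<phi> ` zigzag_covers N = Cat n" using \<phi>_Cat by blast
  qed
  have "twist_rank N black \<omega> = num_inversions n (?\<phi> \<omega>)" if "\<omega> \<in> zigzag_covers N" for \<omega>
  proof -
    have "num_inversions n (?\<phi> \<omega>) = (\<Sum>i\<in>{1..n}. ?H \<omega> (n - i))"
      unfolding num_inversions_eq_sum_code by (intro sum.cong refl \<phi>(2)[OF that])
    \<comment> \<open>Reversal sends \<open>{1..n}\<close> onto \<open>{0..N}\<close>, where the
      height at 0 contributes nothing.\<close>
    also have "\<dots> = sum (?H \<omega>) {0..N}"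
      by (rule sum.reindex_bij_witness[of _ "\<lambda>k. n - k" "\<lambda>i. n - i"]) (auto simp: n)
    also have "\<dots> = sum (?H \<omega>) {1..N}"
      using heights_0[OF heights[OF that]] by (simp add: sum.atLeast_Suc_atMost)
    finally show ?thesis by (simp add: twist_rank_eq[OF N col that])
  qed
  then have "rank_generating_function N black = (\<Sum>\<omega>\<in>zigzag_covers N. monom 1 (num_inversions n (?\<phi> \<omega>)))"
    by (simp add: rank_generating_function_def)
  also have "\<dots> = catalan_poly n"
    unfolding catalan_poly_def by (rule sum.reindex_bij_betw[OF bij])
  finally have rank: "rank_generating_function N black = catalan_poly n" .
  have "poset_isomorphism (zigzag_covers N) (face_twist_order N black)
      (Cat n) (Restr (bruhat_order n) (Cat n)) ?\<phi>"
    unfolding poset_isomorphism_def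
    using partial_order_on_face_twist_order[OF N col] partial_order_on_bruhat_Cat bij order \<phi>_Cat
    by simp
  then show ?thesis using unique rank unfolding N_def[symmetric] by blast
qed

end
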